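(* Let $X=\{X_t,\ t\ge 0\}$ be a centered (real-valued, càdlàg) Lévy process with finite moments of all orders. Let $\sigma^2$ be the variance of the Gaussian part of $X$, let $\nu$ be its Lévy measure, and let $m_k=\int_{\mathbb{R}} x^k\,\nu(dx)$ for $k\ge 2$. Then, for every $n\ge 1$, the process $$M_t^{(n)}=\Gamma_n\big(X_t,\,-(m_2+\sigma^2)t,\,-m_3t,\,\ldots,\,-m_nt\big),\qquad t\ge 0,$$ is a martingale with respect to the filtration associated with $X$, where $\Gamma_n$ is the polynomial expressing the $n$-th moment in terms of the first $n$ cumulants (defined explicitly in the context).
   Context: A Lévy process $X=\{X_t,\ t\ge0\}$ is a real-valued process with $X_0=0$, with stationary and independent increments, continuous in probability, and taken with càdlàg paths. Centered means $\mathbb{E}[X_t]=0$ for all $t$. Finite moments of all orders means $\mathbb{E}[|X_t|^p]<\infty$ for all $p\geq 1$ and $t\geq 0$; this implies that $\nu$ has moments of all orders $\ge 2$, so each $m_k$ ($k\ge 2$) is finite. Polynomials $\Gamma_n$: $\Gamma_0=1$ and, for $n\ge 1$, $$\Gamma_n(x_1,\ldots,x_n)=n!\sum \frac{x_1^{r_1}}{(1!)^{r_1}r_1!}\cdots\frac{x_n^{r_n}}{(n!)^{r_n}r_n!},$$ where the sum is over all non-negative integers $r_1,\ldots,r_n$ such that $\sum_{j=1}^n j r_j=n$. Equivalently, as formal power series in $u$, $\exp\{\sum_{n\ge1}x_n u^n/n!\}=\sum_{n\ge0}\Gamma_n(x_1,\ldots,x_n)u^n/n!$; thus the $n$-th moment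 of a random variable with cumulants $\kappa_1,\kappa_2,\ldots$ is $\Gamma_n(\kappa_1,\ldots,\kappa_n)$. For $n=1$ the expression in the claim is $\Gamma_1(X_t)=X_t$, and for $n=2$ it is $\Gamma_2(X_t,-(m_2+\sigma^2)t)$. *)

theory Defs
  imports "HOL-Probability.Probability" "HOL-Probability.Stopping_Time"
begin

definition cadlag :: "(real \<Rightarrow> real) \<Rightarrow> bool" where
  "cadlag f \<longleftrightarrow>
     (\<forall>t\<ge>0. continuous (at_right t) f) \<and> (\<forall>t>0. \<exists>l. (f \<longlongrightarrow> l) (at_left t))"

text \<open>Processes are indexed by \<^typ>\<open>real\<close>, but only their values at times \<open>t \<ge> 0\<close> matter.\<close>

locale levy_process = prob_space M for M :: "'a measure" +
  fixes X :: "real \<Rightarrow> 'a \<Rightarrow> real"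
  assumes random_variable_X: "0 \<le> t \<Longrightarrow> random_variable borel (X t)"
    and start_zero: "AE \<omega> in M. X 0 \<omega> = 0"
    and indep_increments:
      "0 \<le> \<tau> 0 \<Longrightarrow> (\<And>i. i < n \<Longrightarrow> \<tau> i < \<tau> (Suc i)) \<Longrightarrow>
         indep_vars (\<lambda>_. borel) (\<lambda>i \<omega>. X (\<tau> (Suc i)) \<omega> - X (\<tau> i) \<omega>) {..<n::nat}"
    and stationary_increments:
      "0 \<le> s \<Longrightarrow> 0 \<le> h \<Longrightarrow>
         distr M borel (\<lambda>\<omega>. X (s + h) \<omega> - X s \<omega>) = distr M borel (\<lambda>\<omega>. X h \<omega> - X 0 \<omega>)"
    and continuous_in_probability:
      "0 \<le> t \<Longrightarrow> 0 < \<epsilon> \<Longrightarrow>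
         ((\<lambda>s. prob {\<omega> \<in> space M. \<bar>X s \<omega> - X t \<omega>\<bar> > \<epsilon>}) \<longlongrightarrow> 0) (at t within {0..})"
    and cadlag_paths: "AE \<omega> in M. cadlag (\<lambda>t. X t \<omega>)"

definition levy_measure :: "real measure \<Rightarrow> bool" where
  "levy_measure \<nu> \<longleftrightarrow> sets \<nu> = sets borel \<and> emeasure \<nu> {0} = 0 \<and>
     (\<integral>\<^sup>+x. ennreal (min 1 (x\<^sup>2)) \<partial>\<nu>) < \<infinity>"

definition levy_khintchine_exponent ::
    "real \<Rightarrow> real \<Rightarrow> real measure \<Rightarrow> real \<Rightarrow> complex" where
  "levy_khintchine_exponent b v \<nu> u =
     \<i> * complex_of_real (b * u) - complex_of_real (v * u\<^sup>2 / 2) +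
     (CLINT x|\<nu>. iexp (u * x) - 1 - \<i> * complex_of_real (u * x * indicator {-1..1} x))"

text \<open>
  \<open>characteristic_triplet M X b v \<nu>\<close>: the infinitely divisible law of \<open>X\<^sub>1\<close> has drift \<open>b\<close>
  (relative to the truncation \<open>\<bar>x\<bar> \<le> 1\<close>), Gaussian variance \<open>v\<close> and Levy measure \<open>\<nu>\<close>.
  For a Levy process such a triplet exists and is unique by the Levy-Khintchine theorem, and it
  determines the law of every \<open>X\<^sub>t\<close>, whose characteristic function is the \<open>t\<close>-th power of that
  of \<open>X\<^sub>1\<close>.
\<close>

definition characteristic_triplet ::
    "'a measure \<Rightarrow> (real \<Rightarrow> 'a \<Rightarrow> real) \<Rightarrow> real \<Rightarrow> real \<Rightarrow> real measure \<Rightarrow> bool" where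
  "characteristic_triplet M X b v \<nu> \<longleftrightarrow> 0 \<le> v \<and> levy_measure \<nu> \<and>
     (\<forall>u. char (distr M borel (X 1)) u = exp (levy_khintchine_exponent b v \<nu> u))"

definition natural_filtration ::
    "'a measure \<Rightarrow> (real \<Rightarrow> 'a \<Rightarrow> real) \<Rightarrow> real \<Rightarrow> 'a measure" where
  "natural_filtration M X t =
     sigma (space M) {X s -` A \<inter> space M | s A. s \<in> {0..t} \<and> A \<in> sets borel}"

definition martingale ::
    "'a measure \<Rightarrow> (real \<Rightarrow> 'a measure) \<Rightarrow> (real \<Rightarrow> 'a \<Rightarrow> real) \<Rightarrow> bool" where
  "martingale M F Y \<longleftrightarrow> filtration (space M) F \<and>
     (\<forall>t\<ge>0. subalgebra M (F t) \<and> Y t \<in> borel_measurable (F t) \<and> integrable M (Y t)) \<and>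
     (\<forall>s t. 0 \<le> s \<longrightarrow> s \<le> t \<longrightarrow> (AE \<omega> in M. real_cond_exp M (F s) (Y t) \<omega> = Y s \<omega>))"

text \<open>
  The multi-indices \<open>(r\<^sub>1, \<dots>, r\<^sub>n)\<close> are the extensional functions on \<open>{1..n}\<close>, so each is counted
  once; only \<open>x 1, \<dots>, x n\<close> enter into \<open>Gamma_poly n x\<close>.
\<close>

definition Gamma_indices :: "nat \<Rightarrow> (nat \<Rightarrow> nat) set" where
  "Gamma_indices n = {r \<in> {1..n} \<rightarrow>\<^sub>E UNIV. (\<Sum>j=1..n. j * r j) = n}"

definition Gamma_poly :: "nat \<Rightarrow> (nat \<Rightarrow> real) \<Rightarrow> real" where
  "Gamma_poly n x =
     fact n * (\<Sum>r\<in>Gamma_indices n. \<Prod>j=1..n. x j ^ r j / (fact j ^ r j * fact (r j)))"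

lemma finite_Gamma_indices: "finite (Gamma_indices n)"
proof (rule finite_subset)
  show "Gamma_indices n \<subseteq> {1..n} \<rightarrow>\<^sub>E {0..n}"
  proof
    fix r assume r: "r \<in> Gamma_indices n"
    have "r j \<le> n" if j: "j \<in> {1..n}" for j
    proof -
      have "r j \<le> j * r j" using j by simp
      also have "\<dots> \<le> (\<Sum>j=1..n. j * r j)" using j by (intro member_le_sum) auto
      finally show ?thesis using r by (simp add: Gamma_indices_def)
    qed
    with r show "r \<in> {1..n} \<rightarrow>\<^sub>E {0..n}" by (auto simp: Gamma_indices_def PiE_iff)
  qed
qed (simp add: finite_PiE)

lemma Gamma_poly_0: "Gamma_poly 0 x = 1"
  by (simp add: Gamma_poly_def Gamma_indices_def)

end

theory Submission
  imports Defs
begin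

text \<open>
  Let \<open>F\<^sub>t = (\<Sum>n. E[X\<^sub>t\<^sup>n] u\<^sup>n / n!)\<close> be the formal moment generating series of \<open>X\<^sub>t\<close>. Independence
  and stationarity of the increments give \<open>F\<^sub>s\<^sub>+\<^sub>t = F\<^sub>s F\<^sub>t\<close> and, conditionally on the past up to
  time \<open>s \<le> t\<close>, \<open>E[exp (u X\<^sub>t) | \<F>\<^sub>s] = exp (u X\<^sub>s) F\<^sub>t / F\<^sub>s\<close> coefficientwise; so the coefficients of
  \<open>exp (u X\<^sub>t) / F\<^sub>t\<close> are martingales. The logarithmic derivative \<open>F\<^sub>t' / F\<^sub>t\<close> is additive in \<open>t\<close> with
  coefficients bounded on \<open>[0, 1]\<close>, hence equal to \<open>t F\<^sub>1' / F\<^sub>1\<close>.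
  Comparing the asymptotic expansions at \<open>0\<close> of the two sides of the Levy-Khintchine formula shows
  that \<open>\<nu>\<close> has moments of all orders at least 2 and that \<open>F\<^sub>1' / F\<^sub>1\<close> has the coefficients
  \<open>0, \<sigma>\<^sup>2 + m\<^sub>2, m\<^sub>3 / 2!, m\<^sub>4 / 3!, \<dots>\<close>. Both \<open>exp (u X\<^sub>t) / F\<^sub>t\<close> and the exponential generating function of
  the \<open>\<Gamma>\<^sub>n\<close> in the statement therefore solve \<open>G' = (X\<^sub>t - t F\<^sub>1' / F\<^sub>1) G\<close> with \<open>G(0) = 1\<close>, so they agree.
\<close>

unbundle no vec_syntax
unbundle fps_syntax

section \<open>Asymptotic expansions\<close>

lemma power_in_bigo_nhds_0:
  assumes "n \<le> k"
  shows "(\<lambda>u::real. complex_of_real u ^ k) \<in> O[nhds 0](\<lambda>u. complex_of_real u ^ n)"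
proof (rule bigoI[where c = 1])
  have "eventually (\<lambda>u::real. norm u < 1) (nhds 0)"
    using eventually_nhds_in_open[of "ball 0 1" "0::real"] by (auto simp: dist_norm)
  then show "\<forall>\<^sub>F u in nhds 0. norm (complex_of_real u ^ k) \<le> 1 * norm (complex_of_real u ^ n)"
  proof eventually_elim
    case (elim u)
    then show ?case
      using power_decreasing[OF assms, of "\<bar>u\<bar>"] by (simp add: norm_power)
  qed
qed

text \<open>Strong induction on \<open>k\<close>: with the lower coefficients gone, division by
  \<open>u ^ k\<close> leaves a function that tends to \<open>a k\<close> at 0 yet is bounded by a
  multiple of \<open>\<bar>u\<bar> ^ (n - k)\<close>, hence tends to 0.\<close>

lemma bigo_power_unique:
  fixes a :: "nat \<Rightarrow> complex"
  assumes O: "(\<lambda>u. \<Sum>k<n. a k * complex_of_real u ^ k) \<in> O[nhds 0](\<lambda>u. complex_of_real u ^ n)"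
    and "k < n"
  shows "a k = 0"
  using \<open>k < n\<close>
proof (induction k rule: less_induct)
  case (less k)
  have sum_eq: "(\<Sum>j<n. a j * complex_of_real u ^ j) =
    complex_of_real u ^ k * (a k + complex_of_real u * (\<Sum>j\<in>{Suc k..<n}. a j * complex_of_real u ^ (j - Suc k)))" for u
  proof -
    have "(\<Sum>j<n. a j * complex_of_real u ^ j) = (\<Sum>j\<in>{k..<n}. a j * complex_of_real u ^ j)"
      using less by (intro sum.mono_neutral_right) auto
    also have "\<dots> = a k * complex_of_real u ^ k + (\<Sum>j\<in>{Suc k..<n}. a j * complex_of_real u ^ j)"
      using less.prems by (simp add: sum.atLeast_Suc_lessThan)
    also have "(\<Sum>j\<in>{Suc k..<n}. a j * complex_of_real u ^ j) =
        complex_of_real u ^ Suc k * (\<Sum>j\<in>{Suc k..<n}. a j * complex_of_real u ^ (j - Suc k))"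
      unfolding sum_distrib_left
    proof (intro sum.cong refl)
      fix j assume "j \<in> {Suc k..<n}"
      then have "complex_of_real u ^ j = complex_of_real u ^ Suc k * complex_of_real u ^ (j - Suc k)"
        unfolding power_add[symmetric] by simp
      then show "a j * complex_of_real u ^ j =
          complex_of_real u ^ Suc k * (a j * complex_of_real u ^ (j - Suc k))"
        by simp
    qed
    finally show ?thesis by (simp add: algebra_simps)
  qed
  define h where "h u = a k + complex_of_real u * (\<Sum>j\<in>{Suc k..<n}. a j * complex_of_real u ^ (j - Suc k))" for u
  have h_lim: "(h \<longlongrightarrow> a k + complex_of_real 0 * (\<Sum>j\<in>{Suc k..<n}. a j * complex_of_real 0 ^ (j - Suc k))) (at 0)"
    unfolding h_def by (intro tendsto_intros)
  from O obtain c where c: "\<forall>\<^sub>F u in nhds 0. norm (\<Sum>j<n. a j * complex_of_real u ^ j) \<le> c * norm (complex_of_real u ^ n)"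
    by (elim landau_o.bigE)
  have "\<forall>\<^sub>F u in at 0. norm (h u) \<le> c * \<bar>u\<bar> ^ (n - k)"
    using c[unfolded eventually_nhds_conv_at, THEN conjunct1] eventually_neq_at_within[of 0 "0::real" UNIV]
  proof eventually_elim
    case (elim u)
    have "\<bar>u\<bar> ^ k * norm (h u) = norm (\<Sum>j<n. a j * complex_of_real u ^ j)"
      unfolding sum_eq h_def norm_mult norm_power by simp
    also have "\<dots> \<le> c * norm (complex_of_real u ^ n)"
      by (rule elim)
    also have "norm (complex_of_real u ^ n) = \<bar>u\<bar> ^ k * \<bar>u\<bar> ^ (n - k)"
      using less.prems by (simp add: norm_power power_add[symmetric])
    finally have "\<bar>u\<bar> ^ k * norm (h u) \<le> \<bar>u\<bar> ^ k * (c * \<bar>u\<bar> ^ (n - k))"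
      by (simp add: mult.left_commute)
    then show ?case using elim by simp
  qed
  moreover have "((\<lambda>u. c * \<bar>u\<bar> ^ (n - k)) \<longlongrightarrow> 0) (at (0::real))"
  proof -
    have "((\<lambda>u. c * \<bar>u\<bar> ^ (n - k)) \<longlongrightarrow> c * \<bar>0\<bar> ^ (n - k)) (at (0::real))"
      by (intro tendsto_intros)
    then show ?thesis using less.prems zero_power[of "n - k", where 'a = real] by simp
  qed
  ultimately have "(h \<longlongrightarrow> 0) (at 0)"
    by (rule Lim_null_comparison)
  with h_lim have "a k + complex_of_real 0 * (\<Sum>j\<in>{Suc k..<n}. a j * complex_of_real 0 ^ (j - Suc k)) = 0"
    by (rule tendsto_unique[rotated]) simp
  then show ?case by simp
qed

text \<open>The difference quotient of \<open>exp\<close> at 0 tends to 1, so its norm eventually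
  exceeds 1/2. This serves as a local inverse of \<open>exp\<close>.\<close>

lemma norm_le_exp_minus_1:
  "\<forall>\<^sub>F z in nhds 0. norm (z::complex) \<le> 2 * norm (exp z - 1)"
proof -
  have "((\<lambda>z::complex. norm ((exp z - exp 0) / (z - 0))) \<longlongrightarrow> norm (exp 0 :: complex)) (at 0)"
    using DERIV_exp[of "0::complex"] unfolding has_field_derivative_iff by (intro tendsto_intros) simp
  then have "\<forall>\<^sub>F z::complex in at 0. norm ((exp z - exp 0) / (z - 0)) > 1/2"
    by (rule order_tendstoD) simp
  then have "\<forall>\<^sub>F z::complex in at 0. norm z \<le> 2 * norm (exp z - 1)"
    using eventually_neq_at_within[of 0 "0::complex" UNIV]
  proof eventually_elim
    case (elim z)
    then show ?case by (simp add: norm_divide field_simps)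
  qed
  then show ?thesis by (simp add: eventually_nhds_conv_at)
qed

text \<open>The hypothesis on \<open>F\<close> and \<open>K\<close> says \<open>F = exp K\<close> formally; it makes the derivative of
  \<open>P z * exp (- Q z)\<close> vanish to order \<open>n - 1\<close> at \<open>0\<close>.\<close>

lemma exp_log_truncation_bound:
  fixes F K :: "complex fps"
  assumes F0: "F $ 0 = 1" and K0: "K $ 0 = 0" and F': "fps_deriv F = fps_deriv K * F" and n: "n > 0"
  defines "P \<equiv> (\<lambda>z. \<Sum>k<n. F $ k * z ^ k)" and "Q \<equiv> (\<lambda>z. \<Sum>k<n. K $ k * z ^ k)"
  shows "(\<lambda>z. P z * exp (- Q z) - 1) \<in> O[nhds 0](\<lambda>z. z ^ n)"
proof -
  define p q where "p = (\<Sum>k<n. monom (F $ k) k)" and "q = (\<Sum>k<n. monom (K $ k) k)"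
  have coeff: "coeff p k = (if k < n then F $ k else 0)" "coeff q k = (if k < n then K $ k else 0)" for k
    unfolding p_def q_def by (simp_all add: coeff_sum if_distrib sum.delta cong: if_cong)
  have P: "P = poly p" and Q: "Q = poly q"
    unfolding P_def Q_def p_def q_def by (simp_all add: fun_eq_iff poly_sum poly_monom)
  \<comment> \<open>Below degree \<open>n - 1\<close> only coefficients of index less than
    \<open>n\<close> enter, where \<open>p\<close> and \<open>q\<close> agree with \<open>F\<close>
    and \<open>K\<close>, so \<open>F'\<close> applies.\<close>
  have "coeff (pderiv p - pderiv q * p) j = 0" if "j < n - 1" for j
  proof -
    have "coeff (pderiv p - pderiv q * p) j =
        of_nat (Suc j) * F $ Suc j - (\<Sum>i\<le>j. of_nat (Suc i) * K $ Suc i * F $ (j - i))"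
      using that by (auto simp: coeff_pderiv coeff_mult coeff intro!: sum.cong)
    also have "\<dots> = fps_deriv F $ j - (fps_deriv K * F) $ j"
      by (simp add: fps_mult_nth atLeast0AtMost)
    finally show ?thesis by (simp add: F')
  qed
  then have "monom 1 (n - 1) dvd pderiv p - pderiv q * p"
    by (simp add: monom_1_dvd_iff')
  then obtain r where r: "pderiv p - pderiv q * p = monom 1 (n - 1) * r" ..
  define G where "G z = poly p z * exp (- poly q z)" for z
  have G0: "G 0 = 1"
    using n F0 K0 by (simp add: G_def poly_0_coeff_0 coeff)
  define G' where "G' z = z ^ (n - 1) * (poly r z * exp (- poly q z))" for z
  have G: "(G has_field_derivative G' z) (at z)" for z
  proof -
    have "(G has_field_derivative
        poly (pderiv p) z * exp (- poly q z) + - poly (pderiv q) z * exp (- poly q z) * poly p z) (at z)"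
      unfolding G_def by (auto intro!: derivative_eq_intros poly_DERIV simp: algebra_simps)
    also have "poly (pderiv p) z * exp (- poly q z) + - poly (pderiv q) z * exp (- poly q z) * poly p z =
        poly (pderiv p - pderiv q * p) z * exp (- poly q z)"
      by (simp add: algebra_simps)
    finally show ?thesis by (simp add: r G'_def poly_monom mult.assoc)
  qed
  have "compact (cball (0::complex) 1)" by simp
  then have "bounded ((\<lambda>z. poly r z * exp (- poly q z)) ` cball 0 1)"
    by (intro compact_imp_bounded compact_continuous_image continuous_intros)
  then obtain B where B: "\<forall>z\<in>cball 0 1. norm (poly r z * exp (- poly q z)) \<le> B"
    by (auto simp: bounded_iff)
  \<comment> \<open>Mean value inequality on the disc of radius \<open>norm z\<close>: the
    derivative contributes \<open>norm z ^ (n - 1)\<close> and the distance to 0 the last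
    power.\<close>
  have "norm (G z - 1) \<le> B * norm (z ^ n)" if z: "norm z < 1" for z
  proof -
    have "norm (G z - G 0) \<le> norm z ^ (n - 1) * B * norm (z - 0)"
    proof (rule field_differentiable_bound[of "cball 0 (norm z)"])
      fix w :: complex assume w: "w \<in> cball 0 (norm z)"
      then show "norm (G' w) \<le> norm z ^ (n - 1) * B"
        unfolding G'_def norm_mult[of "w ^ _"] norm_power
        using z B[THEN bspec, of w] by (intro mult_mono power_mono) auto
      show "(G has_field_derivative G' w) (at w within cball 0 (norm z))"
        using G by (rule has_field_derivative_at_within)
    qed auto
    also have "\<dots> = B * norm (z ^ n)"
      using n by (cases n) (auto simp: norm_power norm_mult)
    finally show ?thesis by (simp add: G0)
  qed
  moreover have "\<forall>\<^sub>F z::complex in nhds 0. norm z < 1"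
    using eventually_nhds_in_open[of "ball 0 1" "0::complex"] by (auto simp: dist_norm)
  ultimately show ?thesis
    unfolding P Q G_def[symmetric]
    by (intro bigoI[where c = B]) (auto elim: eventually_mono)
qed

text \<open>With \<open>P\<close> and \<open>Q\<close> the truncations,
  \<open>exp (\<psi> - Q) - 1\<close> is the sum of \<open>(\<phi> - P) * exp (- Q)\<close> and
  \<open>P * exp (- Q) - 1\<close>, both of order \<open>u ^ n\<close>. Since \<open>\<psi>\<close>
  tends to 0, so does \<open>\<psi> - Q\<close>, and the exponential can be inverted locally; the
  limit of \<open>\<psi>\<close> replaces the choice of a branch of the logarithm.\<close>

lemma exp_log_expansion:
  fixes \<phi> \<psi> :: "real \<Rightarrow> complex" and F K :: "complex fps"
  assumes F0: "F $ 0 = 1" and K0: "K $ 0 = 0" and F': "fps_deriv F = fps_deriv K * F"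
    and \<phi>: "(\<lambda>u. \<phi> u - (\<Sum>k<n. F $ k * of_real u ^ k)) \<in> O[nhds 0](\<lambda>u. of_real u ^ n)"
    and exp: "\<And>u. \<phi> u = exp (\<psi> u)" and \<psi>: "(\<psi> \<longlongrightarrow> 0) (nhds 0)"
  shows "(\<lambda>u. \<psi> u - (\<Sum>k<n. K $ k * of_real u ^ k)) \<in> O[nhds 0](\<lambda>u. of_real u ^ n)"
proof (cases "n = 0")
  case True
  \<comment> \<open>For \<open>n = 0\<close> the claim is boundedness of \<open>\<psi>\<close> near
    0.\<close>
  then show ?thesis
    using \<psi> by (auto intro: bigoI_tendsto[where c = 0])
next
  case False
  define P Q where "P z = (\<Sum>k<n. F $ k * z ^ k)" and "Q z = (\<Sum>k<n. K $ k * z ^ k)" for z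
  have of_real: "filterlim complex_of_real (nhds 0) (nhds 0)"
    using tendsto_of_real[of "\<lambda>x. x" "0::real" "nhds 0"] by (simp add: filterlim_ident)
  have Q_lim: "((\<lambda>u. Q (of_real u)) \<longlongrightarrow> 0) (nhds 0)"
  proof -
    have "((\<lambda>u. Q (of_real u)) \<longlongrightarrow> (\<Sum>k<n. K $ k * 0 ^ k)) (nhds 0)"
      unfolding Q_def by (intro tendsto_intros of_real)
    also have "(\<Sum>k<n. K $ k * 0 ^ k) = 0"
      using K0 by (intro sum.neutral) (auto simp: power_0_left)
    finally show ?thesis .
  qed
  have "(\<lambda>u. exp (- Q (of_real u))) \<in> O[nhds 0](\<lambda>_. 1)"
    using tendsto_exp[OF tendsto_minus[OF Q_lim]]
    by (intro bigoI_tendsto[where c = "exp (- 0)"]) auto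
  from landau_o.big.mult[OF \<phi> this]
  have 1: "(\<lambda>u. (\<phi> u - P (of_real u)) * exp (- Q (of_real u))) \<in> O[nhds 0](\<lambda>u. of_real u ^ n)"
    by (simp add: P_def)
  have 2: "(\<lambda>u. P (of_real u) * exp (- Q (of_real u)) - 1) \<in> O[nhds 0](\<lambda>u. of_real u ^ n)"
    using landau_o.big.compose[OF exp_log_truncation_bound[OF F0 K0 F', of n] of_real] False
    by (simp add: P_def Q_def)
  have "(\<lambda>u. exp (\<psi> u - Q (of_real u)) - 1) \<in> O[nhds 0](\<lambda>u. of_real u ^ n)"
    using sum_in_bigo(1)[OF 1 2] by (simp add: exp exp_diff exp_minus algebra_simps divide_inverse)
  moreover have "(\<lambda>u. \<psi> u - Q (of_real u)) \<in> O[nhds 0](\<lambda>u. exp (\<psi> u - Q (of_real u)) - 1)"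
    using eventually_compose_filterlim[OF norm_le_exp_minus_1] tendsto_diff[OF \<psi> Q_lim]
    by (intro bigoI[where c = 2]) simp
  ultimately show ?thesis
    unfolding Q_def by (rule landau_o.big_trans[rotated])
qed

section \<open>Moments of the Levy measure\<close>

lemma levy_measure_integrable_min:
  assumes "levy_measure \<nu>"
  shows "integrable \<nu> (\<lambda>x. min 1 (x\<^sup>2))"
proof (rule integrableI_bounded)
  have [measurable_cong]: "sets \<nu> = sets borel"
    using assms by (simp add: levy_measure_def)
  show "(\<lambda>x. min 1 (x\<^sup>2)) \<in> borel_measurable \<nu>" by measurable
  show "(\<integral>\<^sup>+x. ennreal (norm (min 1 (x\<^sup>2))) \<partial>\<nu>) < \<infinity>"
    using assms by (simp add: levy_measure_def)
qed

definition levy_integrand :: "real \<Rightarrow> real \<Rightarrow> complex" where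
  "levy_integrand u x = iexp (u * x) - 1 - \<i> * complex_of_real (u * x * indicator {-1..1} x)"

text \<open>On \<open>[-1, 1]\<close> the compensated integrand is a Taylor remainder of second
  order; outside it is a difference of two numbers of modulus 1. The constant covers both cases and
  is locally bounded in \<open>u\<close>, as dominated convergence requires.\<close>

lemma norm_levy_integrand_le:
  "norm (levy_integrand u x) \<le> (2 + u\<^sup>2) * min 1 (x\<^sup>2)"
proof (cases "\<bar>x\<bar> \<le> 1")
  case True
  have "norm (levy_integrand u x) = cmod (iexp (u * x) - (\<Sum>k\<le>1. (\<i> * complex_of_real (u * x)) ^ k / fact k))"
    using True by (auto simp: levy_integrand_def abs_le_iff algebra_simps)
  also have "\<dots> \<le> \<bar>u * x\<bar> ^ Suc 1 / fact (Suc 1)"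
    by (rule iexp_approx1)
  also have "\<dots> \<le> (2 + u\<^sup>2) * x\<^sup>2"
    by (simp add: power2_eq_square[symmetric] power_mult_distrib algebra_simps)
  also have "x\<^sup>2 = min 1 (x\<^sup>2)"
    using True by (simp add: abs_square_le_1 min_absorb2)
  finally show ?thesis .
next
  case False
  then have "levy_integrand u x = iexp (u * x) - 1"
    by (auto simp: levy_integrand_def indicator_def)
  then have "norm (levy_integrand u x) \<le> norm (iexp (u * x)) + norm (1 :: complex)"
    by (simp only: norm_triangle_ineq4)
  also have "\<dots> \<le> 2 + u\<^sup>2"
    by simp
  also have "\<dots> = (2 + u\<^sup>2) * min 1 (x\<^sup>2)"
    using False one_le_power[of "\<bar>x\<bar>" 2] by (simp add: min_absorb1)
  finally show ?thesis .
qed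

lemma borel_measurable_levy_integrand [measurable]: "levy_integrand u \<in> borel_measurable borel"
  unfolding levy_integrand_def[abs_def] by measurable

lemma integrable_levy_integrand:
  assumes "levy_measure \<nu>"
  shows "integrable \<nu> (levy_integrand u)"
proof (rule Bochner_Integration.integrable_bound)
  have [measurable_cong]: "sets \<nu> = sets borel"
    using assms by (simp add: levy_measure_def)
  show "integrable \<nu> (\<lambda>x. (2 + u\<^sup>2) * min 1 (x\<^sup>2))"
    by (intro integrable_mult_right levy_measure_integrable_min assms)
  show "levy_integrand u \<in> borel_measurable \<nu>" by measurable
  show "AE x in \<nu>. norm (levy_integrand u x) \<le> norm ((2 + u\<^sup>2) * min 1 (x\<^sup>2))"
    using norm_levy_integrand_le by (auto intro: order_trans)
qed

lemma levy_integral_tendsto_0: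
  assumes "levy_measure \<nu>"
  shows "((\<lambda>u. CLINT x|\<nu>. levy_integrand u x) \<longlongrightarrow> 0) (nhds 0)"
proof -
  have [measurable_cong]: "sets \<nu> = sets borel"
    using assms by (simp add: levy_measure_def)
  have zero: "levy_integrand 0 x = 0" for x
    by (simp add: levy_integrand_def)
  have "((\<lambda>u. CLINT x|\<nu>. levy_integrand u x) \<longlongrightarrow> 0) (at 0)"
    unfolding tendsto_at_iff_sequentially comp_def
  proof (intro allI impI)
    fix U :: "nat \<Rightarrow> real" assume U: "U \<longlonglongrightarrow> 0"
    \<comment> \<open>A convergent sequence is bounded, which yields one dominating function for all
      its members.\<close>
    then obtain B where B: "\<And>n. \<bar>U n\<bar> \<le> B"
      by (metis Bseq_def convergentI convergent_imp_Bseq real_norm_def)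
    have "(\<lambda>n. CLINT x|\<nu>. levy_integrand (U n) x) \<longlonglongrightarrow> (CLINT x|\<nu>. levy_integrand 0 x)"
    proof (rule integral_dominated_convergence)
      show "integrable \<nu> (\<lambda>x. (2 + B\<^sup>2) * min 1 (x\<^sup>2))"
        by (intro integrable_mult_right levy_measure_integrable_min assms)
      show "AE x in \<nu>. (\<lambda>n. levy_integrand (U n) x) \<longlonglongrightarrow> levy_integrand 0 x"
        unfolding levy_integrand_def by (intro AE_I2 tendsto_intros U)
      show "AE x in \<nu>. norm (levy_integrand (U n) x) \<le> (2 + B\<^sup>2) * min 1 (x\<^sup>2)" for n
      proof (rule AE_I2)
        fix x
        have "(U n)\<^sup>2 \<le> B\<^sup>2"
          using B[of n] by (simp add: abs_le_square_iff[symmetric])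
        then have "(2 + (U n)\<^sup>2) * min 1 (x\<^sup>2) \<le> (2 + B\<^sup>2) * min 1 (x\<^sup>2)"
          by (intro mult_right_mono) auto
        with norm_levy_integrand_le[of "U n" x]
        show "norm (levy_integrand (U n) x) \<le> (2 + B\<^sup>2) * min 1 (x\<^sup>2)"
          by linarith
      qed
    qed measurable
    then show "(\<lambda>n. CLINT x|\<nu>. levy_integrand (U n) x) \<longlonglongrightarrow> 0"
      by (simp add: zero)
  qed
  then have "((\<lambda>u. CLINT x|\<nu>. levy_integrand u x) \<longlongrightarrow> (CLINT x|\<nu>. levy_integrand 0 x)) (at 0)"
    by (simp add: zero)
  \<comment> \<open>Unlike \<open>at 0\<close>, the filter \<open>nhds 0\<close> sees the point 0;
    the limit is the value there.\<close>
  then have "((\<lambda>u. CLINT x|\<nu>. levy_integrand u x) \<longlongrightarrow> (CLINT x|\<nu>. levy_integrand 0 x)) (nhds 0)"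
    by (simp only: tendsto_nhds_iff)
  then show ?thesis
    by (simp add: zero)
qed

section \<open>Central differences and finiteness of the even moments\<close>

text \<open>With \<open>e = iexp y\<close>, the base \<open>2 - 2 * cos y\<close> equals
  \<open>- inverse e * (1 - e)\<^sup>2\<close>; the binomial theorem expands its \<open>k\<close>-th
  power.\<close>

lemma central_difference_iexp:
  "complex_of_real ((2 - 2 * cos y) ^ k) =
   (\<Sum>j\<le>2*k. (-1) ^ (j + k) * of_nat (2 * k choose j) * iexp ((real j - real k) * y))"
proof -
  define e where "e = iexp y"
  have e: "e \<noteq> 0" by (simp add: e_def)
  have "complex_of_real (2 - 2 * cos y) = 2 - (e + inverse e)"
    unfolding e_def cis_conv_exp[symmetric] cis_inverse by (simp add: complex_eq_iff)
  also have "\<dots> = - inverse e * (- e + 1)\<^sup>2"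
    using e by (simp add: power2_eq_square field_simps)
  finally have "complex_of_real ((2 - 2 * cos y) ^ k) = (- inverse e) ^ k * (- e + 1) ^ (2 * k)"
    by (simp only: of_real_power power_mult_distrib power_mult)
  also have "\<dots> = (\<Sum>j\<le>2*k. (- inverse e) ^ k * (of_nat (2 * k choose j) * (- e) ^ j))"
    by (simp only: binomial_ring sum_distrib_left power_one mult_1_right)
  also have "\<dots> = (\<Sum>j\<le>2*k. (-1) ^ (j + k) * of_nat (2 * k choose j) * iexp ((real j - real k) * y))"
  proof (intro sum.cong refl)
    fix j
    have "iexp ((real j - real k) * y) = e ^ j * inverse e ^ k"
      by (simp add: e_def exp_of_nat_mult[symmetric] exp_minus[symmetric] exp_add[symmetric] algebra_simps)
    then show "(- inverse e) ^ k * (of_nat (2 * k choose j) * (- e) ^ j) =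
        (-1) ^ (j + k) * of_nat (2 * k choose j) * iexp ((real j - real k) * y)"
      by (simp add: power_minus[of e] power_minus[of "inverse e"] power_add)
  qed
  finally show ?thesis .
qed

text \<open>Up to the factors \<open>(-1) ^ k\<close> and \<open>fact d\<close>, the sum is the
  coefficient of degree \<open>d\<close> of \<open>exp (- k u) * (exp u - 1) ^ (2 * k)\<close>, a
  series that starts in degree \<open>2 * k\<close>.\<close>

lemma central_difference_power:
  assumes "d < 2 * k"
  shows "(\<Sum>j\<le>2*k. (-1) ^ (j + k) * of_nat (2 * k choose j) * (of_nat j - of_nat k) ^ d) = (0 :: 'a :: field_char_0)"
proof -
  define E where "E = fps_exp (- of_nat k :: 'a) * (fps_exp 1 - 1) ^ (2 * k)"
  have "(fps_exp (1 :: 'a) - 1) ^ (2 * k) $ i = 0" if "i < 2 * k" for i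
    using startsby_zero_power_prefix[of "fps_exp (1 :: 'a) - 1" "2 * k"] that by simp
  then have "E $ d = 0"
    using assms unfolding E_def fps_mult_nth by (intro sum.neutral) auto
  moreover have "E = (\<Sum>j\<le>2*k. fps_const ((-1) ^ j * of_nat (2 * k choose j)) * fps_exp (of_nat j - of_nat k))"
  proof -
    have "E = (\<Sum>j\<le>2*k. fps_exp (- of_nat k) * (of_nat (2 * k choose j) * fps_exp 1 ^ j * (- 1) ^ (2 * k - j)))"
      using binomial_ring[of "fps_exp (1 :: 'a)" "-1" "2 * k"]
      by (simp add: E_def sum_distrib_left)
    also have "\<dots> = (\<Sum>j\<le>2*k. fps_const ((-1) ^ j * of_nat (2 * k choose j)) * fps_exp (of_nat j - of_nat k))"
    proof (intro sum.cong refl)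
      fix j assume "j \<in> {..2 * k}"
      then have "(- 1) ^ (2 * k - j) = fps_const ((- 1 :: 'a) ^ j)"
        by (auto simp: minus_one_power_iff fps_const_neg[symmetric] simp del: fps_const_neg)
      moreover have "fps_exp (of_nat j - of_nat k :: 'a) = fps_exp (- of_nat k) * fps_exp 1 ^ j"
        by (simp add: fps_exp_power_mult fps_exp_add_mult[symmetric])
      ultimately show "fps_exp (- of_nat k) * (of_nat (2 * k choose j) * fps_exp 1 ^ j * (- 1) ^ (2 * k - j)) =
          fps_const ((-1) ^ j * of_nat (2 * k choose j)) * fps_exp (of_nat j - of_nat k :: 'a)"
        by (simp add: fps_of_nat[symmetric] fps_const_mult[symmetric] mult_ac del: fps_const_mult)
    qed
    finally show ?thesis .
  qed
  ultimately have "(\<Sum>j\<le>2*k. (-1) ^ j * of_nat (2 * k choose j) * (of_nat j - of_nat k) ^ d / fact d) = (0 :: 'a)"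
    by (simp add: fps_sum_nth)
  then have "(\<Sum>j\<le>2*k. (-1) ^ j * of_nat (2 * k choose j) * (of_nat j - of_nat k) ^ d) = (0 :: 'a)"
    by (simp add: sum_divide_distrib[symmetric])
  then have "(-1) ^ k * (\<Sum>j\<le>2*k. (-1) ^ j * of_nat (2 * k choose j) * (of_nat j - of_nat k) ^ d) = (0 :: 'a)"
    by simp
  then show ?thesis
    by (simp add: sum_distrib_left power_add mult_ac)
qed

text \<open>The central difference of order \<open>2 * k\<close> of \<open>u \<mapsto> iexp (u * x)\<close> at \<open>0\<close> is,
  up to sign, \<open>(2 - 2 * cos (u * x)) ^ k\<close>, which is nonnegative and equivalent to \<open>(u * x) ^ (2 * k)\<close>, while such a difference annihilates
  polynomials of degree less than \<open>2 * k\<close>. Fatou's lemma then bounds the moment.\<close>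

lemma levy_measure_even_moment:
  fixes a :: "nat \<Rightarrow> complex"
  assumes \<nu>: "levy_measure \<nu>" and k: "k > 0"
    and a: "(\<lambda>u. (CLINT x|\<nu>. levy_integrand u x) - (\<Sum>d<2*k. a d * of_real u ^ d)) \<in>
      O[nhds 0](\<lambda>u. of_real u ^ (2 * k))"
  shows "integrable \<nu> (\<lambda>x. x ^ (2 * k))"
proof -
  have [measurable_cong]: "sets \<nu> = sets borel"
    using \<nu> by (simp add: levy_measure_def)
  define c :: "nat \<Rightarrow> complex" where "c j = (-1) ^ (j + k) * of_nat (2 * k choose j)" for j
  define s where "s j = real j - real k" for j
  define \<chi> where "\<chi> u = (CLINT x|\<nu>. levy_integrand u x)" for u
  define h where "h u x = (2 - 2 * cos (u * x)) ^ k" for u x :: real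
  have c_power: "(\<Sum>j\<le>2*k. c j * of_real (s j) ^ d) = 0" if "d < 2 * k" for d
    using central_difference_power[OF that, where 'a = complex] by (simp add: c_def s_def)
  \<comment> \<open>The terms -1 and the compensator, of degree 0 and 1 in \<open>s j\<close>, are
    annihilated by the difference because \<open>2 * k > 1\<close>.\<close>
  have h_eq: "complex_of_real (h u x) = (\<Sum>j\<le>2*k. c j * levy_integrand (s j * u) x)" for u x
  proof -
    have "(\<Sum>j\<le>2*k. c j * levy_integrand (s j * u) x) =
      (\<Sum>j\<le>2*k. c j * iexp (s j * (u * x)) - c j * of_real (s j) ^ 0 -
        c j * of_real (s j) ^ 1 * (\<i> * complex_of_real (u * x * indicator {-1..1} x)))"
      by (intro sum.cong refl) (simp add: levy_integrand_def algebra_simps)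
    also have "\<dots> = (\<Sum>j\<le>2*k. c j * iexp (s j * (u * x))) - (\<Sum>j\<le>2*k. c j * of_real (s j) ^ 0) -
      (\<Sum>j\<le>2*k. c j * of_real (s j) ^ 1) * (\<i> * complex_of_real (u * x * indicator {-1..1} x))"
      by (simp only: sum_distrib_right sum_subtractf)
    also have "\<dots> = (\<Sum>j\<le>2*k. c j * iexp (s j * (u * x)))"
      using c_power[of 0] c_power[of 1] k by simp
    finally show ?thesis
      using central_difference_iexp[of "u * x" k] by (simp add: h_def c_def s_def)
  qed
  have int_h: "complex_integrable \<nu> (\<lambda>x. of_real (h u x))" for u
    unfolding h_eq by (intro Bochner_Integration.integrable_sum integrable_mult_right integrable_levy_integrand \<nu>)
  have int_h_eq: "complex_of_real (LINT x|\<nu>. h u x) = (\<Sum>j\<le>2*k. c j * \<chi> (s j * u))" for u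
  proof -
    have "complex_of_real (LINT x|\<nu>. h u x) = (CLINT x|\<nu>. of_real (h u x))"
      by simp
    also have "\<dots> = (\<Sum>j\<le>2*k. c j * \<chi> (s j * u))"
      unfolding h_eq \<chi>_def
      by (subst Bochner_Integration.integral_sum)
         (auto intro!: integrable_mult_right integrable_levy_integrand \<nu>)
    finally show ?thesis .
  qed
  \<comment> \<open>The polynomials subtracted here cancel in the sum over \<open>j\<close> by
    \<open>c_power\<close>, so the integral of \<open>h u\<close> inherits the order of the
    remainders.\<close>
  have "(\<lambda>u. \<Sum>j\<le>2*k. c j * (\<chi> (s j * u) - (\<Sum>d<2*k. a d * of_real (s j * u) ^ d))) \<in>
      O[nhds 0](\<lambda>u. of_real u ^ (2 * k))"
  proof (rule big_sum_in_bigo)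
    fix j
    have "((\<lambda>u. s j * u) \<longlongrightarrow> s j * 0) (nhds 0)"
      by (intro tendsto_intros filterlim_ident)
    then have "(\<lambda>u. \<chi> (s j * u) - (\<Sum>d<2*k. a d * of_real (s j * u) ^ d)) \<in>
        O[nhds 0](\<lambda>u. of_real (s j * u) ^ (2 * k))"
      using landau_o.big.compose[OF a, of "\<lambda>u. s j * u" "nhds 0"] by (simp add: \<chi>_def)
    also have "(\<lambda>u. complex_of_real (s j * u) ^ (2 * k)) \<in> O[nhds 0](\<lambda>u. of_real u ^ (2 * k))"
      by (simp add: power_mult_distrib)
    finally show "(\<lambda>u. c j * (\<chi> (s j * u) - (\<Sum>d<2*k. a d * of_real (s j * u) ^ d))) \<in>
        O[nhds 0](\<lambda>u. of_real u ^ (2 * k))"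
      by (cases "c j = 0") auto
  qed
  also have "(\<lambda>u. \<Sum>j\<le>2*k. c j * (\<chi> (s j * u) - (\<Sum>d<2*k. a d * of_real (s j * u) ^ d))) =
      (\<lambda>u. complex_of_real (LINT x|\<nu>. h u x))"
  proof
    fix u
    have "(\<Sum>j\<le>2*k. c j * (\<Sum>d<2*k. a d * of_real (s j * u) ^ d)) =
        (\<Sum>j\<le>2*k. \<Sum>d<2*k. (a d * of_real u ^ d) * (c j * of_real (s j) ^ d))"
      by (simp add: sum_distrib_left power_mult_distrib mult_ac)
    also have "\<dots> = (\<Sum>d<2*k. (a d * of_real u ^ d) * (\<Sum>j\<le>2*k. c j * of_real (s j) ^ d))"
      by (subst sum.swap) (simp add: sum_distrib_left)
    also have "\<dots> = 0"
      by (simp add: c_power)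
    finally show "(\<Sum>j\<le>2*k. c j * (\<chi> (s j * u) - (\<Sum>d<2*k. a d * of_real (s j * u) ^ d))) =
        complex_of_real (LINT x|\<nu>. h u x)"
      by (simp add: int_h_eq right_diff_distrib sum_subtractf)
  qed
  finally obtain C where "\<forall>\<^sub>F u in nhds 0. norm (complex_of_real (LINT x|\<nu>. h u x)) \<le> C * norm (complex_of_real u ^ (2 * k))"
    by (elim landau_o.bigE)
  then have C: "\<forall>\<^sub>F u in nhds 0. (LINT x|\<nu>. h u x) \<le> C * \<bar>u\<bar> ^ (2 * k)"
    by (rule eventually_mono) (auto simp: norm_power)
  define u where "u n = inverse (real (Suc n))" for n
  have u_pos: "u n > 0" for n
    by (simp add: u_def)
  have u_lim: "u \<longlonglongrightarrow> 0"
    unfolding u_def[abs_def] by (rule LIMSEQ_inverse_real_of_nat)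
  have h_nonneg: "h u x \<ge> 0" for u x
    by (simp add: h_def)
  \<comment> \<open>Since \<open>2 - 2 * cos (u * x)\<close> is the square of
    \<open>2 * sin (x / 2 * u)\<close>, the quotient is a power of a difference quotient of sine at
    0.\<close>
  have lim: "(\<lambda>n. h (u n) x / u n ^ (2 * k)) \<longlonglongrightarrow> x ^ (2 * k)" for x
  proof -
    have "((\<lambda>t. 2 * sin (x / 2 * t)) has_real_derivative x) (at 0)"
      by (auto intro!: derivative_eq_intros)
    then have "((\<lambda>t. 2 * sin (x / 2 * t) / t) \<longlongrightarrow> x) (at 0)"
      by (simp add: has_field_derivative_iff)
    then have "(\<lambda>n. 2 * sin (x / 2 * u n) / u n) \<longlonglongrightarrow> x"
      by (rule filterlim_compose) (use u_lim u_pos in \<open>auto simp: filterlim_at less_le\<close>)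
    then have "(\<lambda>n. (2 * sin (x / 2 * u n) / u n) ^ (2 * k)) \<longlonglongrightarrow> x ^ (2 * k)"
      by (intro tendsto_intros)
    moreover have "(2 * sin (x / 2 * u n) / u n) ^ (2 * k) = h (u n) x / u n ^ (2 * k)" for n
    proof -
      have "(2 * sin (x / 2 * u n))\<^sup>2 = 2 - 2 * cos (u n * x)"
        using cos_double_sin[of "x / 2 * u n"] by (simp add: power_mult_distrib mult_ac)
      then show ?thesis
        by (simp only: h_def power_divide power_mult)
    qed
    ultimately show ?thesis by simp
  qed
  have "(\<integral>\<^sup>+x. ennreal (x ^ (2 * k)) \<partial>\<nu>) = (\<integral>\<^sup>+x. liminf (\<lambda>n. ennreal (h (u n) x / u n ^ (2 * k))) \<partial>\<nu>)"
    using lim by (intro nn_integral_cong lim_imp_Liminf[symmetric] tendsto_ennrealI) auto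
  also have "\<dots> \<le> liminf (\<lambda>n. \<integral>\<^sup>+x. ennreal (h (u n) x / u n ^ (2 * k)) \<partial>\<nu>)"
    unfolding h_def by (intro nn_integral_liminf) measurable
  \<comment> \<open>The bound \<open>C\<close> holds eventually in \<open>n\<close>, which suffices
    for the limsup.\<close>
  also have "\<dots> \<le> limsup (\<lambda>n. \<integral>\<^sup>+x. ennreal (h (u n) x / u n ^ (2 * k)) \<partial>\<nu>)"
    by (rule Liminf_le_Limsup) simp
  also have "\<dots> \<le> ennreal C"
  proof (rule Limsup_bounded)
    show "\<forall>\<^sub>F n in sequentially. (\<integral>\<^sup>+x. ennreal (h (u n) x / u n ^ (2 * k)) \<partial>\<nu>) \<le> ennreal C"
      using eventually_compose_filterlim[OF C u_lim]
    proof eventually_elim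
      case (elim n)
      have "integrable \<nu> (h (u n))"
        using int_h[of "u n"] by (simp only: complex_of_real_integrable_eq)
      then have "(\<integral>\<^sup>+x. ennreal (h (u n) x / u n ^ (2 * k)) \<partial>\<nu>) = ennreal (LINT x|\<nu>. h (u n) x / u n ^ (2 * k))"
        using u_pos[of n] h_nonneg by (intro nn_integral_eq_integral) auto
      also have "\<dots> \<le> ennreal C"
        using elim u_pos[of n] by (intro ennreal_leI) (simp add: field_simps)
      finally show ?case .
    qed
  qed
  finally have "(\<integral>\<^sup>+x. ennreal (x ^ (2 * k)) \<partial>\<nu>) \<le> ennreal C" .
  from le_less_trans[OF this ennreal_less_top]
  have "(\<integral>\<^sup>+x. ennreal (norm (x ^ (2 * k))) \<partial>\<nu>) < \<infinity>"
    by (simp add: power_mult)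
  then show ?thesis
    by (intro integrableI_bounded) measurable
qed

text \<open>The even moments are finite by the preceding lemma, hence all moments from order 2 on.
  The integral then has a Taylor expansion with known coefficients, and uniqueness of asymptotic
  expansions identifies \<open>a k\<close>.\<close>

lemma levy_measure_moments:
  fixes a :: "nat \<Rightarrow> complex"
  assumes \<nu>: "levy_measure \<nu>"
    and a: "\<And>n. (\<lambda>u. (CLINT x|\<nu>. levy_integrand u x) - (\<Sum>d<n. a d * of_real u ^ d)) \<in>
      O[nhds 0](\<lambda>u. of_real u ^ n)"
    and k: "k \<ge> 2"
  shows "a k = \<i> ^ k * of_real (LINT x|\<nu>. x ^ k) / fact k"
proof -
  have [measurable_cong]: "sets \<nu> = sets borel"
    using \<nu> by (simp add: levy_measure_def)
  have int: "integrable \<nu> (\<lambda>x. x ^ d)" if d: "d \<ge> 2" for d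
  proof (rule Bochner_Integration.integrable_bound)
    show "integrable \<nu> (\<lambda>x. x ^ (2 * 1) + x ^ (2 * d))"
      using d by (intro Bochner_Integration.integrable_add levy_measure_even_moment[OF \<nu> _ a]) auto
    show "AE x in \<nu>. norm (x ^ d) \<le> norm (x ^ (2 * 1) + x ^ (2 * d))"
    proof (rule AE_I2)
      fix x :: real
      have "\<bar>x\<bar> ^ d \<le> \<bar>x\<bar> ^ 2 + \<bar>x\<bar> ^ (2 * d)"
      proof (cases "\<bar>x\<bar> \<le> 1")
        case True
        then have "\<bar>x\<bar> ^ d \<le> \<bar>x\<bar> ^ 2"
          using d by (intro power_decreasing) auto
        then show ?thesis by (simp add: add_increasing2)
      next
        case False
        then have "\<bar>x\<bar> ^ d \<le> \<bar>x\<bar> ^ (2 * d)"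
          by (intro power_increasing) auto
        then show ?thesis by (simp add: add_increasing)
      qed
      then show "norm (x ^ d) \<le> norm (x ^ (2 * 1) + x ^ (2 * d))"
        by (simp add: power_abs power_mult)
    qed
  qed measurable
  \<comment> \<open>One order beyond \<open>k\<close>, so that \<open>k\<close> is among the
    coefficients determined up to \<open>O(u ^ n)\<close>.\<close>
  define n where "n = Suc k"
  \<comment> \<open>What the compensator leaves of the linear term: the jumps of size above 1, where
    \<open>\<bar>x\<bar> \<le> x\<^sup>2\<close>.\<close>
  define big where "big x = x * indicator (- {-1..1}) x" for x :: real
  define R where "R u x = iexp (u * x) - (\<Sum>d\<le>k. (\<i> * complex_of_real (u * x)) ^ d / fact d)" for u x
  have int_big: "integrable \<nu> big"
  proof (rule Bochner_Integration.integrable_bound[OF int[OF order_refl]])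
    show "AE x in \<nu>. norm (big x) \<le> norm (x\<^sup>2)"
    proof (rule AE_I2)
      fix x :: real
      have "\<bar>x\<bar> * 1 \<le> \<bar>x\<bar> * \<bar>x\<bar>" if "\<bar>x\<bar> > 1"
        using that by (intro mult_left_mono) auto
      then show "norm (big x) \<le> norm (x\<^sup>2)"
        by (auto simp: big_def indicator_def power2_eq_square abs_mult abs_le_iff)
    qed
  qed (simp add: big_def[abs_def])
  define p where "p d = (if d = 0 then 0 else if d = 1 then \<i> * of_real (LINT x|\<nu>. big x)
    else \<i> ^ d * of_real (LINT x|\<nu>. x ^ d) / fact d)" for d
  have split: "{..k} = insert 0 (insert 1 {2..k})"
    using k by auto
  have eq: "levy_integrand u x = R u x + (\<i> * of_real u * of_real (big x) +
      (\<Sum>d=2..k. (\<i> * of_real u) ^ d / fact d * of_real (x ^ d)))" for u x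
    by (simp add: R_def split levy_integrand_def big_def power_mult_distrib indicator_def algebra_simps)
  have int_poly: "complex_integrable \<nu> (\<lambda>x. \<i> * of_real u * of_real (big x) +
      (\<Sum>d=2..k. (\<i> * of_real u) ^ d / fact d * of_real (x ^ d)))" for u
    using int_big int
    by (intro Bochner_Integration.integrable_add Bochner_Integration.integrable_sum integrable_mult_right)
       (simp_all only: complex_of_real_integrable_eq atLeastAtMost_iff)
  have int_R: "complex_integrable \<nu> (R u)" for u
    using Bochner_Integration.integrable_diff[OF integrable_levy_integrand[OF \<nu>, of u] int_poly[of u]]
    by (simp add: eq)
  have int_poly_eq: "(CLINT x|\<nu>. \<i> * of_real u * of_real (big x) +
      (\<Sum>d=2..k. (\<i> * of_real u) ^ d / fact d * of_real (x ^ d))) = (\<Sum>d<n. p d * of_real u ^ d)" for u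
  proof -
    have "(CLINT x|\<nu>. \<i> * of_real u * of_real (big x) +
        (\<Sum>d=2..k. (\<i> * of_real u) ^ d / fact d * of_real (x ^ d))) =
      (CLINT x|\<nu>. \<i> * of_real u * of_real (big x)) +
        (\<Sum>d=2..k. CLINT x|\<nu>. (\<i> * of_real u) ^ d / fact d * of_real (x ^ d))"
      using int_big int
      by (subst Bochner_Integration.integral_add)
         (auto simp: complex_of_real_integrable_eq simp del: of_real_power
           intro!: Bochner_Integration.integral_sum Bochner_Integration.integrable_sum integrable_mult_right)
    also have "\<dots> = \<i> * of_real u * of_real (LINT x|\<nu>. big x) +
        (\<Sum>d=2..k. (\<i> * of_real u) ^ d / fact d * of_real (LINT x|\<nu>. x ^ d))"
      by (simp only: integral_mult_right_zero integral_complex_of_real)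
    also have "\<dots> = (\<Sum>d\<le>k. p d * of_real u ^ d)"
      unfolding split by (simp add: p_def power_mult_distrib mult_ac)
    finally show ?thesis by (simp only: n_def lessThan_Suc_atMost)
  qed
  have "(\<lambda>u. (CLINT x|\<nu>. levy_integrand u x) - (\<Sum>d<n. p d * of_real u ^ d)) \<in> O[nhds 0](\<lambda>u. of_real u ^ n)"
  proof (rule bigoI[where c = "LINT x|\<nu>. \<bar>x\<bar> ^ n / fact n"], rule always_eventually, rule allI)
    fix u :: real
    have "norm (CLINT x|\<nu>. R u x) \<le> (LINT x|\<nu>. \<bar>u\<bar> ^ n * (\<bar>x\<bar> ^ n / fact n))"
    proof (rule Bochner_Integration.integral_norm_bound_integral[OF int_R])
      have "2 \<le> n"
        using k by (simp add: n_def)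
      from integrable_abs[OF int[OF this]]
      have "integrable \<nu> (\<lambda>x. \<bar>x\<bar> ^ n)"
        by (simp only: power_abs)
      then show "integrable \<nu> (\<lambda>x. \<bar>u\<bar> ^ n * (\<bar>x\<bar> ^ n / fact n))"
        by (intro integrable_mult_right integrable_divide)
      show "norm (R u x) \<le> \<bar>u\<bar> ^ n * (\<bar>x\<bar> ^ n / fact n)" for x
        using iexp_approx1[of "u * x" k]
        by (simp only: R_def n_def abs_mult power_mult_distrib times_divide_eq_right)
    qed
    moreover have "(CLINT x|\<nu>. levy_integrand u x) = (CLINT x|\<nu>. R u x) + (\<Sum>d<n. p d * of_real u ^ d)"
      unfolding eq Bochner_Integration.integral_add[OF int_R int_poly] int_poly_eq ..
    ultimately show "norm ((CLINT x|\<nu>. levy_integrand u x) - (\<Sum>d<n. p d * of_real u ^ d)) \<le>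
        (LINT x|\<nu>. \<bar>x\<bar> ^ n / fact n) * norm (complex_of_real u ^ n)"
      by (simp add: norm_power mult.commute)
  qed
  from sum_in_bigo(2)[OF this a[of n]]
  have "(\<lambda>u. \<Sum>d<n. (a d - p d) * of_real u ^ d) \<in> O[nhds 0](\<lambda>u. of_real u ^ n)"
    by (simp add: sum_subtractf left_diff_distrib)
  then have "a k - p k = 0"
    by (rule bigo_power_unique) (simp add: n_def)
  then show ?thesis
    using k by (simp add: p_def)
qed

section \<open>From the Levy-Khintchine formula to the cumulants\<close>

text \<open>\<open>K\<close> is the formal logarithm of the moment series. The characteristic
  function expands with the moments as coefficients, so its exponent expands with those of
  \<open>K\<close>; removing drift and Gaussian part leaves the jump integral, to which
  \<open>levy_measure_moments\<close> applies.\<close>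

lemma levy_khintchine_cumulants:
  fixes X :: "'a \<Rightarrow> real" and K :: "real fps"
  assumes M: "prob_space M" and X: "X \<in> borel_measurable M"
    and moments: "\<And>k. integrable M (\<lambda>\<omega>. X \<omega> ^ k)"
    and \<nu>: "levy_measure \<nu>"
    and char: "\<And>u. char (distr M borel X) u = exp (levy_khintchine_exponent b v \<nu> u)"
    and K0: "K $ 0 = 0"
    and K: "fps_deriv (Abs_fps (\<lambda>k. (LINT \<omega>|M. X \<omega> ^ k) / fact k)) =
      fps_deriv K * Abs_fps (\<lambda>k. (LINT \<omega>|M. X \<omega> ^ k) / fact k)"
    and k: "k \<ge> 2"
  shows "fact k * K $ k = (if k = 2 then v else 0) + (LINT x|\<nu>. x ^ k)"
proof -
  interpret prob_space M by fact
  define F where "F = Abs_fps (\<lambda>k. (LINT \<omega>|M. X \<omega> ^ k) / fact k)"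
  \<comment> \<open>The substitution of \<open>\<i> * u\<close> for \<open>u\<close>, which passes
    from moment series to characteristic functions and preserves the relation between
    \<open>F\<close> and \<open>K\<close>.\<close>
  define Fc Kc where "Fc = Abs_fps (\<lambda>k. \<i> ^ k * complex_of_real (F $ k))"
    and "Kc = Abs_fps (\<lambda>k. \<i> ^ k * complex_of_real (K $ k))"
  have Fc0: "Fc $ 0 = 1"
    by (simp add: Fc_def F_def prob_space)
  have Kc0: "Kc $ 0 = 0"
    by (simp add: Kc_def K0)
  have Kc: "fps_deriv Fc = fps_deriv Kc * Fc"
  proof (rule fps_ext)
    fix n
    have "fps_deriv Fc $ n = \<i> ^ Suc n * complex_of_real (fps_deriv F $ n)"
      by (simp add: Fc_def)
    also have "\<dots> = \<i> ^ Suc n * complex_of_real (\<Sum>i=0..n. fps_deriv K $ i * F $ (n - i))"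
      by (simp only: K[folded F_def] fps_mult_nth)
    also have "\<dots> = (\<Sum>i=0..n. \<i> ^ Suc n * (complex_of_real (fps_deriv K $ i) * complex_of_real (F $ (n - i))))"
      by (simp add: sum_distrib_left)
    also have "\<dots> = (\<Sum>i=0..n. fps_deriv Kc $ i * Fc $ (n - i))"
    proof (intro sum.cong refl)
      fix i assume "i \<in> {0..n}"
      then have "\<i> ^ Suc n = \<i> ^ Suc i * \<i> ^ (n - i)"
        by (simp add: power_add[symmetric])
      then show "\<i> ^ Suc n * (complex_of_real (fps_deriv K $ i) * complex_of_real (F $ (n - i))) =
          fps_deriv Kc $ i * Fc $ (n - i)"
        by (simp add: Fc_def Kc_def)
    qed
    finally show "fps_deriv Fc $ n = (fps_deriv Kc * Fc) $ n"
      by (simp add: fps_mult_nth)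
  qed
  define \<phi> where "\<phi> = char (distr M borel X)"
  define \<psi> where "\<psi> = levy_khintchine_exponent b v \<nu>"
  define \<chi> where "\<chi> u = (CLINT x|\<nu>. levy_integrand u x)" for u
  define g where "g u = \<i> * complex_of_real (b * u) - complex_of_real (v * u\<^sup>2 / 2)" for u
  have \<psi>_eq: "\<psi> u = g u + \<chi> u" for u
    by (simp add: \<psi>_def g_def \<chi>_def levy_khintchine_exponent_def levy_integrand_def)
  have "(g \<longlongrightarrow> \<i> * complex_of_real (b * 0) - complex_of_real (v * 0\<^sup>2 / 2)) (nhds 0)"
    unfolding g_def by (intro tendsto_intros filterlim_ident) auto
  then have "((\<lambda>u. g u + \<chi> u) \<longlongrightarrow> 0 + 0) (nhds 0)"
    unfolding \<chi>_def by (intro tendsto_add levy_integral_tendsto_0 \<nu>) simp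
  then have \<psi>_lim: "(\<psi> \<longlongrightarrow> 0) (nhds 0)"
    by (simp add: \<psi>_eq[abs_def])
  have \<phi>: "(\<lambda>u. \<phi> u - (\<Sum>k<n. Fc $ k * of_real u ^ k)) \<in> O[nhds 0](\<lambda>u. of_real u ^ n)" for n
  proof -
    \<comment> \<open>The remainder after the term of degree \<open>n\<close> is bounded here by a
      multiple of \<open>\<bar>u\<bar> ^ n\<close> only; the term itself has that order too and is
      dropped afterwards.\<close>
    have "(\<lambda>u. \<phi> u - (\<Sum>k\<le>n. ((\<i> * complex_of_real u) ^ k / fact k) * of_real (expectation (\<lambda>x. X x ^ k))))
        \<in> O[nhds 0](\<lambda>u. of_real u ^ n)"
    proof (rule bigoI[where c = "2 / fact n * expectation (\<lambda>x. \<bar>X x\<bar> ^ n)"], rule always_eventually, rule allI)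
      fix u
      show "norm (\<phi> u - (\<Sum>k\<le>n. ((\<i> * complex_of_real u) ^ k / fact k) * of_real (expectation (\<lambda>x. X x ^ k))))
          \<le> 2 / fact n * expectation (\<lambda>x. \<bar>X x\<bar> ^ n) * norm (complex_of_real u ^ n)"
        using char_approx1'[OF moments X refl, where n = n and t = u]
        by (simp add: \<phi>_def norm_power mult_ac)
    qed
    also have "(\<lambda>u. \<phi> u - (\<Sum>k\<le>n. ((\<i> * complex_of_real u) ^ k / fact k) * of_real (expectation (\<lambda>x. X x ^ k)))) =
        (\<lambda>u. (\<phi> u - (\<Sum>k<n. Fc $ k * of_real u ^ k)) - Fc $ n * of_real u ^ n)"
      by (simp add: Fc_def F_def lessThan_Suc_atMost[symmetric] power_mult_distrib mult_ac fun_eq_iff)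
    finally have "(\<lambda>u. (\<phi> u - (\<Sum>k<n. Fc $ k * of_real u ^ k)) - Fc $ n * of_real u ^ n)
      \<in> O[nhds 0](\<lambda>u. of_real u ^ n)" .
    moreover have "(\<lambda>u. Fc $ n * complex_of_real u ^ n) \<in> O[nhds 0](\<lambda>u. of_real u ^ n)"
      by (cases "Fc $ n = 0") auto
    ultimately have "(\<lambda>u. (\<phi> u - (\<Sum>k<n. Fc $ k * of_real u ^ k)) - Fc $ n * of_real u ^ n
      + Fc $ n * of_real u ^ n) \<in> O[nhds 0](\<lambda>u. of_real u ^ n)"
      by (rule sum_in_bigo)
    then show ?thesis by simp
  qed
  have \<psi>: "(\<lambda>u. \<psi> u - (\<Sum>k<n. Kc $ k * of_real u ^ k)) \<in> O[nhds 0](\<lambda>u. of_real u ^ n)" for n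
    by (rule exp_log_expansion[OF Fc0 Kc0 Kc \<phi> _ \<psi>_lim]) (simp add: \<phi>_def \<psi>_def char)
  define q :: "nat \<Rightarrow> complex" where "q d = (if d = 1 then \<i> * of_real b else if d = 2 then - of_real v / 2 else 0)" for d
  have g_eq: "g u = (\<Sum>d<3. q d * of_real u ^ d)" for u
    by (simp add: g_def q_def eval_nat_numeral)
  have g: "(\<lambda>u. g u - (\<Sum>d<n. q d * of_real u ^ d)) \<in> O[nhds 0](\<lambda>u. of_real u ^ n)" for n
  proof -
    have "g u - (\<Sum>d<n. q d * of_real u ^ d) = (\<Sum>d\<in>{n..<3}. q d * of_real u ^ d)" for u
    proof (cases "n \<le> 3")
      case True
      then show ?thesis
        using sum.atLeastLessThan_concat[of 0 n 3 "\<lambda>d. q d * of_real u ^ d"]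
        unfolding g_eq lessThan_atLeast0 by (simp only: zero_le algebra_simps diff_add_cancel)
    next
      case False
      then have "(\<Sum>d<n. q d * of_real u ^ d) = g u"
        unfolding g_eq by (intro sum.mono_neutral_right) (auto simp: q_def)
      then show ?thesis using False by simp
    qed
    moreover have "(\<lambda>u. \<Sum>d\<in>{n..<3}. q d * complex_of_real u ^ d) \<in> O[nhds 0](\<lambda>u. of_real u ^ n)"
    proof (rule big_sum_in_bigo)
      fix d assume "d \<in> {n..<3}"
      then show "(\<lambda>u. q d * complex_of_real u ^ d) \<in> O[nhds 0](\<lambda>u. of_real u ^ n)"
        using power_in_bigo_nhds_0[of n d] by (cases "q d = 0") auto
    qed
    ultimately show ?thesis by simp
  qed
  have "(\<lambda>u. \<chi> u - (\<Sum>d<n. (Kc $ d - q d) * of_real u ^ d)) \<in> O[nhds 0](\<lambda>u. of_real u ^ n)" for n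
    using sum_in_bigo(2)[OF \<psi>[of n] g[of n]]
    by (simp add: \<psi>_eq left_diff_distrib sum_subtractf algebra_simps)
  then have "Kc $ k - q k = \<i> ^ k * of_real (LINT x|\<nu>. x ^ k) / fact k"
    unfolding \<chi>_def by (rule levy_measure_moments[OF \<nu> _ k])
  \<comment> \<open>For \<open>k = 2\<close> the Gaussian coefficient \<open>- v / 2\<close> is
    \<open>\<i> ^ 2\<close> times \<open>v / 2\<close>, so the factor \<open>\<i> ^ k\<close>
    cancels throughout.\<close>
  then have "\<i> ^ k * (complex_of_real (K $ k) + (if k = 2 then of_real v / 2 else 0)
      - (if k = 2 then of_real v else 0)) = \<i> ^ k * of_real ((LINT x|\<nu>. x ^ k) / fact k)"
    using k by (auto simp: Kc_def q_def)
  then have "complex_of_real (K $ k) - (if k = 2 then of_real v / 2 else 0) = of_real ((LINT x|\<nu>. x ^ k) / fact k)"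
    unfolding mult_cancel_left by (auto split: if_splits)
  then have "complex_of_real (K $ k - (if k = 2 then v / 2 else 0)) = of_real ((LINT x|\<nu>. x ^ k) / fact k)"
    by (simp split: if_splits)
  then have "K $ k - (if k = 2 then v / 2 else 0) = (LINT x|\<nu>. x ^ k) / fact k"
    by (simp only: of_real_eq_iff)
  then show ?thesis
    by (simp add: field_simps split: if_splits)
qed

section \<open>The generating function of the polynomials \<open>\<Gamma>\<^sub>n\<close>\<close>

text \<open>Summing over multi-indices with a fixed number \<open>N\<close> of entries, independent of the weighted
  degree \<open>n\<close>, makes the generating function a finite product.\<close>

definition weighted_indices :: "nat \<Rightarrow> nat \<Rightarrow> (nat \<Rightarrow> nat) set" where
  "weighted_indices N n = {r \<in> {1..N} \<rightarrow>\<^sub>E UNIV. (\<Sum>j=1..N. j * r j) = n}"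

text \<open>The factor that the \<open>j\<close>-th cumulant contributes to the exponential of the
  cumulant series.\<close>

definition exp_monomial :: "(nat \<Rightarrow> real) \<Rightarrow> nat \<Rightarrow> real fps" where
  "exp_monomial x j = fps_exp (x j / fact j) oo fps_X ^ j"

lemma finite_weighted_indices: "finite (weighted_indices N n)"
proof (rule finite_subset)
  show "weighted_indices N n \<subseteq> {1..N} \<rightarrow>\<^sub>E {0..n}"
  proof
    fix r assume r: "r \<in> weighted_indices N n"
    have "r j \<le> n" if j: "j \<in> {1..N}" for j
    proof -
      have "r j \<le> j * r j" using j by simp
      also have "\<dots> \<le> (\<Sum>j=1..N. j * r j)" using j by (intro member_le_sum) auto
      finally show ?thesis using r by (simp add: weighted_indices_def)
    qed
    with r show "r \<in> {1..N} \<rightarrow>\<^sub>E {0..n}" by (auto simp: weighted_indices_def PiE_iff)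
  qed
qed (simp add: finite_PiE)

lemma exp_monomial_nth:
  assumes "j > 0"
  shows "exp_monomial x j $ n = (if j dvd n then (x j / fact j) ^ (n div j) / fact (n div j) else 0)"
proof -
  have "exp_monomial x j $ n = (\<Sum>i=0..n. (x j / fact j) ^ i / fact i * (if n = j * i then 1 else 0))"
    by (simp add: exp_monomial_def fps_compose_nth power_mult[symmetric])
  also have "\<dots> = (if j dvd n then (x j / fact j) ^ (n div j) / fact (n div j) else 0)"
  proof (cases "j dvd n")
    case True
    then obtain k where k: "n = j * k" ..
    have "(\<Sum>i=0..n. (x j / fact j) ^ i / fact i * (if n = j * i then 1 else 0)) =
        (\<Sum>i\<in>{k}. (x j / fact j) ^ i / fact i)"
      using assms by (intro sum.mono_neutral_cong_right) (auto simp: k)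
    then show ?thesis using assms by (simp add: k)
  qed (auto intro!: sum.neutral)
  finally show ?thesis .
qed

text \<open>Induction on \<open>N\<close>: fixing the last entry \<open>k\<close> leaves an index of
  weight \<open>n - Suc N * k\<close>, which is the Cauchy product with a factor supported on
  multiples of \<open>Suc N\<close>.\<close>

lemma sum_weighted_indices_conv_fps_prod:
  "(\<Sum>r\<in>weighted_indices N n. \<Prod>j=1..N. x j ^ r j / (fact j ^ r j * fact (r j))) =
   (\<Prod>j=1..N. exp_monomial x j) $ n"
proof (induction N arbitrary: n)
  case 0
  have "weighted_indices 0 n = (if n = 0 then {\<lambda>_. undefined} else {})"
    by (auto simp: weighted_indices_def)
  then show ?case by auto
next
  case (Suc N)
  define w where "w M r = (\<Prod>j=1..M. x j ^ r j / (fact j ^ r j * fact (r j)))" for M and r :: "nat \<Rightarrow> nat"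
  define I where "I = (SIGMA k:{k. Suc N * k \<le> n}. weighted_indices N (n - Suc N * k))"
  have w_cong: "w N (r(Suc N := k)) = w N r" for r k
    unfolding w_def by (intro prod.cong) auto
  have sum_cong: "(\<Sum>j=1..N. j * (r(Suc N := k)) j) = (\<Sum>j=1..N. j * r j)" for r k
    by (intro sum.cong) auto
  have fin: "finite {k. Suc N * k \<le> n}"
    by (rule finite_subset[of _ "{..n}"]) auto
  \<comment> \<open>Resetting the last entry to \<open>undefined\<close> makes the remaining index
    extensional on \<open>{1..N}\<close>.\<close>
  have "(\<Sum>r\<in>weighted_indices (Suc N) n. w (Suc N) r) =
      (\<Sum>(k, r)\<in>I. w (Suc N) (r(Suc N := k)))"
  proof (rule sum.reindex_bij_witness[where
        i = "\<lambda>(k, r). r(Suc N := k)" and j = "\<lambda>r. (r (Suc N), r(Suc N := undefined))"])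
    fix r assume r: "r \<in> weighted_indices (Suc N) n"
    then show "(\<lambda>(k, r). r(Suc N := k)) (r (Suc N), r(Suc N := undefined)) = r"
      by simp
    have "(\<Sum>j=1..N. j * r j) + Suc N * r (Suc N) = n"
      using r by (simp add: weighted_indices_def)
    then have "(\<Sum>j=1..N. j * (r(Suc N := undefined)) j) = n - Suc N * r (Suc N)"
      and "Suc N * r (Suc N) \<le> n"
      unfolding sum_cong by linarith+
    moreover have "r(Suc N := undefined) \<in> {1..N} \<rightarrow>\<^sub>E UNIV"
      using r by (auto simp: weighted_indices_def PiE_iff extensional_def le_Suc_eq)
    ultimately show "(r (Suc N), r(Suc N := undefined)) \<in> I"
      unfolding I_def weighted_indices_def by blast
  next
    fix p assume "p \<in> I"
    then obtain k r where p: "p = (k, r)" "Suc N * k \<le> n" and r: "r \<in> weighted_indices N (n - Suc N * k)"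
      by (auto simp: I_def)
    have "r (Suc N) = undefined"
      using r by (auto simp: weighted_indices_def PiE_iff extensional_def)
    then show "(\<lambda>r. (r (Suc N), r(Suc N := undefined))) ((\<lambda>(k, r). r(Suc N := k)) p) = p"
      by (auto simp: p)
    show "(\<lambda>(k, r). r(Suc N := k)) p \<in> weighted_indices (Suc N) n"
      using r p sum_cong[of r k] by (auto simp: weighted_indices_def PiE_iff extensional_def)
  qed auto
  also have "\<dots> = (\<Sum>k\<in>{k. Suc N * k \<le> n}. \<Sum>r\<in>weighted_indices N (n - Suc N * k).
      w N r * (x (Suc N) ^ k / (fact (Suc N) ^ k * fact k)))"
    unfolding I_def
    by (subst sum.Sigma[OF fin, symmetric])
       (auto simp: finite_weighted_indices w_cong[symmetric] w_def[of "Suc N"] w_def[of N] simp del: mult_Suc)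
  also have "\<dots> = (\<Sum>k\<in>{k. Suc N * k \<le> n}.
      (\<Prod>j=1..N. exp_monomial x j) $ (n - Suc N * k) * exp_monomial x (Suc N) $ (Suc N * k))"
    unfolding w_def sum_distrib_right[symmetric] Suc.IH
    by (intro sum.cong refl) (simp add: exp_monomial_nth power_divide del: mult_Suc fact_Suc)
  also have "\<dots> = (\<Sum>i\<in>(\<lambda>k. Suc N * k) ` {k. Suc N * k \<le> n}.
      exp_monomial x (Suc N) $ i * (\<Prod>j=1..N. exp_monomial x j) $ (n - i))"
    by (subst sum.reindex) (auto intro!: inj_onI simp: mult.commute simp del: mult_Suc mult_Suc_right)
  \<comment> \<open>Degrees that are not multiples of \<open>Suc N\<close> contribute zero.\<close>
  also have "\<dots> = (\<Sum>i=0..n. exp_monomial x (Suc N) $ i * (\<Prod>j=1..N. exp_monomial x j) $ (n - i))"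
    by (intro sum.mono_neutral_left) (auto simp: exp_monomial_nth simp del: mult_Suc elim!: dvdE)
  also have "\<dots> = (\<Prod>j=1..Suc N. exp_monomial x j) $ n"
    by (simp add: fps_mult_nth[symmetric] mult.commute)
  finally show ?case by (simp add: w_def)
qed

lemma fps_deriv_exp_monomial:
  assumes "j > 0"
  shows "fps_deriv (exp_monomial x j) = fps_const (x j / fact (j - 1)) * fps_X ^ (j - 1) * exp_monomial x j"
proof -
  have "fps_deriv (exp_monomial x j) = fps_const (x j / fact j) * exp_monomial x j * fps_deriv (fps_X ^ j)"
    unfolding exp_monomial_def using assms
    by (simp add: fps_compose_deriv fps_compose_mult_distrib)
  also have "fps_deriv (fps_X ^ j) = fps_const (of_nat j) * fps_X ^ (j - 1)"
    using assms by (intro fps_ext) auto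
  also have "fps_const (x j / fact j) * exp_monomial x j * (fps_const (of_nat j) * fps_X ^ (j - 1)) =
      fps_const (x j / fact j * of_nat j) * fps_X ^ (j - 1) * exp_monomial x j"
    by (simp add: algebra_simps flip: fps_const_mult)
  also have "x j / fact j * of_nat j = x j / fact (j - 1)"
    using assms by (simp add: fact_reduce field_simps)
  finally show ?thesis .
qed

lemma fps_deriv_prod_exp_monomial:
  "fps_deriv (\<Prod>j=1..N. exp_monomial x j) =
   (\<Sum>j=1..N. fps_const (x j / fact (j - 1)) * fps_X ^ (j - 1)) * (\<Prod>j=1..N. exp_monomial x j)"
  by (induction N) (simp_all add: fps_deriv_exp_monomial algebra_simps)

text \<open>A factor with index above \<open>n\<close> has constant term 1 and no further term up to
  degree \<open>n\<close>, so it leaves the coefficient unchanged.\<close>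

lemma Gamma_poly_conv_weighted_indices:
  assumes "n \<le> N"
  shows "Gamma_poly n x = fact n * (\<Prod>j=1..N. exp_monomial x j) $ n"
proof -
  have "(\<Prod>j=1..N. exp_monomial x j) $ n = (\<Prod>j=1..n. exp_monomial x j) $ n"
    using assms
  proof (induction N rule: dec_induct)
    case (step N)
    have "(\<Prod>j=1..Suc N. exp_monomial x j) $ n =
        (\<Sum>i=0..n. exp_monomial x (Suc N) $ i * (\<Prod>j=1..N. exp_monomial x j) $ (n - i))"
      by (simp add: fps_mult_nth mult.commute)
    also have "\<dots> = (\<Sum>i\<in>{0}. exp_monomial x (Suc N) $ i * (\<Prod>j=1..N. exp_monomial x j) $ (n - i))"
      using step.hyps by (intro sum.mono_neutral_right) (auto simp: exp_monomial_nth dest: dvd_imp_le)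
    finally show ?case using step.IH by (simp add: exp_monomial_nth)
  qed simp
  then show ?thesis
    using sum_weighted_indices_conv_fps_prod[of x n n]
    by (simp add: Gamma_poly_def Gamma_indices_def weighted_indices_def)
qed

text \<open>Each coefficient of \<open>G\<close> is one of a finite product of exponentials, whose
  logarithmic derivative is the sum of those of its factors.\<close>

lemma fps_deriv_Gamma_poly:
  fixes x :: "nat \<Rightarrow> real"
  defines "G \<equiv> Abs_fps (\<lambda>n. Gamma_poly n x / fact n)"
  shows "fps_deriv G = Abs_fps (\<lambda>n. x (Suc n) / fact n) * G"
proof (rule fps_ext)
  fix n
  \<comment> \<open>\<open>Suc n\<close> factors, since the derivative in degree \<open>n\<close>
    involves the coefficient of degree \<open>Suc n\<close>.\<close>
  define P where "P = (\<Prod>j=1..Suc n. exp_monomial x j)"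
  have G: "G $ k = P $ k" if "k \<le> Suc n" for k
    using Gamma_poly_conv_weighted_indices[OF that, of x] by (simp add: G_def P_def)
  have "fps_deriv G $ n = fps_deriv P $ n"
    by (simp add: G)
  also have "\<dots> = (\<Sum>i=0..n. (\<Sum>j=1..Suc n. fps_const (x j / fact (j - 1)) * fps_X ^ (j - 1)) $ i * P $ (n - i))"
    unfolding P_def fps_deriv_prod_exp_monomial by (simp add: fps_mult_nth)
  also have "\<dots> = (\<Sum>i=0..n. x (Suc i) / fact i * G $ (n - i))"
  proof (intro sum.cong refl)
    fix i assume i: "i \<in> {0..n}"
    have "(\<Sum>j=1..Suc n. fps_const (x j / fact (j - 1)) * fps_X ^ (j - 1)) $ i =
        (\<Sum>j=1..Suc n. if j = Suc i then x j / fact (j - 1) else 0)"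
      unfolding fps_sum_nth by (intro sum.cong) auto
    also have "\<dots> = x (Suc i) / fact i"
      using i by (subst sum.delta) auto
    finally show "(\<Sum>j=1..Suc n. fps_const (x j / fact (j - 1)) * fps_X ^ (j - 1)) $ i * P $ (n - i) =
        x (Suc i) / fact i * G $ (n - i)"
      by (simp add: G)
  qed
  finally show "fps_deriv G $ n = (Abs_fps (\<lambda>n. x (Suc n) / fact n) * G) $ n"
    by (simp add: fps_mult_nth)
qed

text \<open>In degree \<open>m\<close> the equation determines \<open>Suc m\<close> times the next
  coefficient from earlier ones, and characteristic 0 permits the division.\<close>

lemma fps_linear_ode_unique:
  fixes A G H :: "'a :: field_char_0 fps"
  assumes "fps_deriv G = A * G" "fps_deriv H = A * H" "G $ 0 = H $ 0"
  shows "G = H"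
proof (rule fps_ext)
  fix n
  show "G $ n = H $ n"
  proof (induction n rule: less_induct)
    case (less n)
    show ?case
    proof (cases n)
      case (Suc m)
      have "(A * G) $ m = (A * H) $ m"
        using less Suc by (auto simp: fps_mult_nth intro!: sum.cong)
      then have "fps_deriv G $ m = fps_deriv H $ m"
        by (simp add: assms)
      then have "of_nat (Suc m) * G $ Suc m = of_nat (Suc m) * H $ Suc m"
        by simp
      then show ?thesis
        unfolding Suc mult_cancel_left of_nat_eq_0_iff by simp
    qed (simp add: assms)
  qed
qed

section \<open>Independence of the increments from the past\<close>

text \<open>Turns finitely many observation times into the increasing grid that
  \<open>indep_increments\<close> expects.\<close>

lemma finite_strict_enumeration:
  fixes S :: "'a :: linorder set"
  assumes "finite S" "S \<noteq> {}"
  obtains n and \<tau> :: "nat \<Rightarrow> 'a"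
  where "\<And>i. i < n \<Longrightarrow> \<tau> i < \<tau> (Suc i)" "S = \<tau> ` {..n}" "\<tau> 0 = Min S" "\<tau> n = Max S"
proof -
  define L where "L = sorted_list_of_set S"
  define n where "n = length L - 1"
  have set_L: "set L = S"
    using assms by (simp add: L_def)
  then have L: "L \<noteq> []"
    using assms by auto
  then have len: "length L = Suc n"
    by (simp add: n_def)
  have less: "L ! i < L ! j" if "i < j" "j \<le> n" for i j
    using sorted_wrt_nth_less[of "(<)" L i j] that len
    by (simp add: L_def)
  then have le: "L ! i \<le> L ! j" if "i \<le> j" "j \<le> n" for i j
    using that by (cases "i = j") (auto simp: less_imp_le)
  have S: "S = (\<lambda>i. L ! i) ` {..n}"
    unfolding set_L[symmetric] set_conv_nth len by (auto simp: less_Suc_eq_le)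
  show thesis
  proof (rule that[of n "\<lambda>i. L ! i"])
    show "L ! 0 = Min S"
      by (rule Min_eqI[symmetric]) (auto simp: S intro: le)
    show "L ! n = Max S"
      by (rule Max_eqI[symmetric]) (auto simp: S intro: le)
  qed (use less S in auto)
qed

section \<open>The natural filtration\<close>

lemma space_natural_filtration [simp]: "space (natural_filtration M X t) = space M"
  by (auto simp: natural_filtration_def space_measure_of_conv)

lemma sets_natural_filtration:
  "sets (natural_filtration M X t) =
    sigma_sets (space M) {X s -` A \<inter> space M | s A. s \<in> {0..t} \<and> A \<in> sets borel}"
  unfolding natural_filtration_def by (rule sets_measure_of) auto

lemma measurable_natural_filtration:
  assumes "0 \<le> s" "s \<le> t"
  shows "X s \<in> borel_measurable (natural_filtration M X t)"
proof (rule measurableI)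
  fix A :: "real set" assume "A \<in> sets borel"
  then show "X s -` A \<inter> space (natural_filtration M X t) \<in> sets (natural_filtration M X t)"
    unfolding sets_natural_filtration space_natural_filtration
    using assms by (intro sigma_sets.Basic) auto
qed simp

lemma filtration_natural_filtration: "filtration (space M) (natural_filtration M X)"
proof
  show "sets (natural_filtration M X i) \<le> sets (natural_filtration M X j)" if "i \<le> j" for i j
    unfolding sets_natural_filtration using that by (intro sigma_sets_mono') force
qed simp

section \<open>Cylinder events and future increments\<close>

context levy_process
begin

lemma subalgebra_natural_filtration: "subalgebra M (natural_filtration M X t)"
  unfolding subalgebra_def sets_natural_filtration space_natural_filtration
  using random_variable_X by (auto intro!: sets.sigma_sets_subset elim: measurable_sets)

text \<open>An intersection-stable class containing the generators of the natural filtration, on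
  which independence can be checked.\<close>

definition cylinders :: "real \<Rightarrow> 'a set set" where
  "cylinders s = {(\<Inter>r\<in>J. X r -` A r) \<inter> space M | J A.
     finite J \<and> J \<subseteq> {0..s} \<and> (\<forall>r\<in>J. A r \<in> sets borel)}"

lemma Int_stable_cylinders: "Int_stable (cylinders s)"
proof (rule Int_stableI)
  fix a a' assume "a \<in> cylinders s" "a' \<in> cylinders s"
  then obtain J A J' A' where
    a: "a = (\<Inter>r\<in>J. X r -` A r) \<inter> space M" "finite J" "J \<subseteq> {0..s}" "\<forall>r\<in>J. A r \<in> sets borel" and
    a': "a' = (\<Inter>r\<in>J'. X r -` A' r) \<inter> space M" "finite J'" "J' \<subseteq> {0..s}" "\<forall>r\<in>J'. A' r \<in> sets borel"
    unfolding cylinders_def by blast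
  \<comment> \<open>A time occurring in only one of the two index sets is unconstrained by the other
    event, hence \<open>UNIV\<close>.\<close>
  define A'' where "A'' r = (if r \<in> J then A r else UNIV) \<inter> (if r \<in> J' then A' r else UNIV)" for r
  have "a \<inter> a' = (\<Inter>r\<in>J \<union> J'. X r -` A'' r) \<inter> space M"
    unfolding a a' A''_def by (auto split: if_splits)
  moreover have "\<forall>r\<in>J \<union> J'. A'' r \<in> sets borel"
    using a a' by (auto simp: A''_def)
  ultimately show "a \<inter> a' \<in> cylinders s"
    unfolding cylinders_def using a a' by (auto intro!: exI[of _ "J \<union> J'"] exI[of _ A''])
qed

lemma cylinders_events:
  assumes "a \<in> cylinders s"
  shows "a \<in> events"
proof -
  obtain J A where a: "a = (\<Inter>r\<in>J. X r -` A r) \<inter> space M" "finite J" "J \<subseteq> {0..s}" "\<forall>r\<in>J. A r \<in> sets borel"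
    using assms unfolding cylinders_def by blast
  have "a = {\<omega>\<in>space M. \<forall>r\<in>J. X r \<omega> \<in> A r}"
    by (auto simp: a)
  also have "\<dots> \<in> events"
    using a random_variable_X
    by (intro sets.sets_Collect_finite_All) (auto intro!: measurable_sets_Collect simp: subset_iff)
  finally show ?thesis .
qed

text \<open>On a grid from 0 through \<open>s\<close> to \<open>t\<close>, the differences
  \<open>X r - X 0\<close> with \<open>r \<le> s\<close> are partial sums of increments that are
  jointly independent of the last one. As \<open>X 0\<close> vanishes almost surely,
  \<open>X r\<close> may be replaced by \<open>X r - X 0\<close>.\<close>

lemma prob_cylinder_Int_increment:
  assumes s: "0 \<le> s" "s < t" and a: "a \<in> cylinders s" and B: "B \<in> sets borel"
  defines "b \<equiv> (\<lambda>\<omega>. X t \<omega> - X s \<omega>) -` B \<inter> space M"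
  shows "prob (a \<inter> b) = prob a * prob b"
proof -
  obtain J A where a_eq: "a = (\<Inter>r\<in>J. X r -` A r) \<inter> space M" and J: "finite J" "J \<subseteq> {0..s}"
      and A: "\<And>r. r \<in> J \<Longrightarrow> A r \<in> sets borel"
    using a unfolding cylinders_def by blast
  \<comment> \<open>Adjoining 0 makes the partial sums telescope to \<open>X r - X 0\<close>;
    adjoining \<open>s\<close> makes the last increment \<open>X t - X s\<close>.\<close>
  define S where "S = insert 0 (insert s J)"
  have S: "finite S" "S \<noteq> {}"
    using J by (auto simp: S_def)
  obtain n and \<sigma> :: "nat \<Rightarrow> real" where \<sigma>: "\<And>i. i < n \<Longrightarrow> \<sigma> i < \<sigma> (Suc i)" "S = \<sigma> ` {..n}"
      "\<sigma> 0 = Min S" "\<sigma> n = Max S"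
    using finite_strict_enumeration[OF S] by blast
  have "Min S = 0"
    using S s J by (intro Min_eqI) (auto simp: S_def)
  have "Max S = s"
    using S s J by (intro Max_eqI) (auto simp: S_def)
  define \<tau> where "\<tau> = \<sigma>(Suc n := t)"
  have \<tau>0: "\<tau> 0 = 0" and \<tau>n: "\<tau> n = s" "\<tau> (Suc n) = t"
    using \<sigma> \<open>Min S = 0\<close> \<open>Max S = s\<close> by (auto simp: \<tau>_def)
  have \<tau>_less: "\<tau> i < \<tau> (Suc i)" if "i < Suc n" for i
    using \<sigma>(1)[of i] that \<tau>n s by (cases "i = n") (auto simp: \<tau>_def)
  define Y where "Y i \<omega> = X (\<tau> (Suc i)) \<omega> - X (\<tau> i) \<omega>" for i \<omega>
  have indep: "indep_vars (\<lambda>_. borel) Y {..<Suc n}"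
    unfolding Y_def[abs_def] using \<tau>0 \<tau>_less by (intro indep_increments) auto
  have sum_Y: "(\<Sum>i<k. Y i \<omega>) = X (\<tau> k) \<omega> - X 0 \<omega>" for k \<omega>
    unfolding Y_def using sum_lessThan_telescope[of "\<lambda>i. X (\<tau> i) \<omega>" k] by (simp add: \<tau>0)
  \<comment> \<open>The grid position of \<open>r\<close>, that is, the number of increments that
    sum to \<open>X r - X 0\<close>.\<close>
  define idx where "idx r = inv_into {..n} \<sigma> r" for r
  have idx: "idx r \<le> n" "\<tau> (idx r) = r" if "r \<in> J" for r
  proof -
    have "r \<in> \<sigma> ` {..n}"
      using that \<sigma>(2) by (auto simp: S_def)
    then show "idx r \<le> n" "\<tau> (idx r) = r"
      using inv_into_into[of r \<sigma> "{..n}"] f_inv_into_f[of r \<sigma> "{..n}"]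
      by (auto simp: idx_def \<tau>_def)
  qed
  define V where "V = (\<lambda>\<omega>. \<lambda>i\<in>{..<n}. Y i \<omega>)"
  define W where "W = (\<lambda>\<omega>. \<lambda>i\<in>{n}. Y i \<omega>)"
  have "indep_var (PiM {..<n} (\<lambda>_. borel)) V (PiM {n} (\<lambda>_. borel)) W"
    unfolding V_def W_def by (rule indep_var_restrict[OF indep]) auto
  then have VW: "indep_set (sigma_sets (space M) {V -` C \<inter> space M | C. C \<in> sets (PiM {..<n} (\<lambda>_. borel))})
      (sigma_sets (space M) {W -` C \<inter> space M | C. C \<in> sets (PiM {n} (\<lambda>_. borel))})"
    and V: "V \<in> measurable M (PiM {..<n} (\<lambda>_. borel))"
    unfolding indep_var_eq by auto
  define C where "C = {f \<in> space (PiM {..<n} (\<lambda>_. borel :: real measure)). \<forall>r\<in>J. (\<Sum>i<idx r. f i) \<in> A r}"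
  have C: "C \<in> sets (PiM {..<n} (\<lambda>_. borel))"
    unfolding C_def
  proof (rule sets.sets_Collect_finite_All[OF _ J(1)])
    fix r assume r: "r \<in> J"
    have "(\<lambda>f. \<Sum>i<idx r. f i) \<in> borel_measurable (PiM {..<n} (\<lambda>_. borel :: real measure))"
      using idx(1)[OF r] by (intro borel_measurable_sum measurable_component_singleton) auto
    from measurable_sets[OF this A[OF r]]
    show "{f \<in> space (PiM {..<n} (\<lambda>_. borel :: real measure)). (\<Sum>i<idx r. f i) \<in> A r}
        \<in> sets (PiM {..<n} (\<lambda>_. borel))"
      by (simp add: vimage_def Int_def conj_commute)
  qed
  \<comment> \<open>The version of \<open>a\<close> written through increments; it agrees with
    \<open>a\<close> up to a null set.\<close>
  define a' where "a' = V -` C \<inter> space M"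
  have a'_iff: "\<omega> \<in> a' \<longleftrightarrow> (\<forall>r\<in>J. X r \<omega> - X 0 \<omega> \<in> A r)" if "\<omega> \<in> space M" for \<omega>
  proof -
    have "(\<Sum>i<idx r. V \<omega> i) = X r \<omega> - X 0 \<omega>" if "r \<in> J" for r
      using idx[OF that] by (simp add: V_def sum_Y)
    then show ?thesis
      using that measurable_space[OF V that] by (auto simp: a'_def C_def)
  qed
  have a': "a' \<in> sigma_sets (space M) {V -` C \<inter> space M | C. C \<in> sets (PiM {..<n} (\<lambda>_. borel))}"
    unfolding a'_def using C by (intro sigma_sets.Basic) blast
  have b: "b \<in> sigma_sets (space M) {W -` C \<inter> space M | C. C \<in> sets (PiM {n} (\<lambda>_. borel))}"
  proof -
    have "(\<lambda>f. f n) \<in> borel_measurable (PiM {n} (\<lambda>_. borel :: real measure))"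
      by (intro measurable_component_singleton) auto
    from measurable_sets[OF this B]
    have "(\<lambda>f. f n) -` B \<inter> space (PiM {n} (\<lambda>_. borel :: real measure)) \<in> sets (PiM {n} (\<lambda>_. borel))" .
    moreover have "b = W -` ((\<lambda>f. f n) -` B \<inter> space (PiM {n} (\<lambda>_. borel :: real measure))) \<inter> space M"
      by (auto simp: b_def W_def Y_def \<tau>n space_PiM)
    ultimately show ?thesis
      by (intro sigma_sets.Basic) blast
  qed
  have a'_ev: "a' \<in> events" and b_ev: "b \<in> events"
    using a' b indep_setD_ev1[OF VW] indep_setD_ev2[OF VW] by auto
  have AE: "AE \<omega> in M. \<omega> \<in> a \<longleftrightarrow> \<omega> \<in> a'"
    using start_zero
  proof (eventually_elim)
    case (elim \<omega>)
    show ?case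
    proof (cases "\<omega> \<in> space M")
      case True
      with elim show ?thesis by (simp add: a'_iff a_eq)
    qed (simp add: a_eq a'_def)
  qed
  have "prob (a \<inter> b) = prob (a' \<inter> b)"
    using AE cylinders_events[OF a] a'_ev b_ev by (intro finite_measure_eq_AE) auto
  also have "\<dots> = prob a' * prob b"
    by (rule indep_setD[OF VW a' b])
  also have "prob a' = prob a"
    using AE cylinders_events[OF a] a'_ev by (intro finite_measure_eq_AE) auto
  finally show ?thesis .
qed

text \<open>Independence passes from intersection-stable classes to the sigma-algebras they
  generate.\<close>

lemma indep_increment_natural_filtration:
  assumes s: "0 \<le> s" "s < t"
  shows "indep_set (sets (natural_filtration M X s))
    (sigma_sets (space M) {(\<lambda>\<omega>. X t \<omega> - X s \<omega>) -` B \<inter> space M | B. B \<in> sets borel})"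
proof -
  define D where "D = (\<lambda>\<omega>. X t \<omega> - X s \<omega>)"
  have D [measurable]: "random_variable borel D"
    unfolding D_def using random_variable_X s by (intro borel_measurable_diff) auto
  have "indep_set (sigma_sets (space M) (cylinders s))
      (sigma_sets (space M) {D -` B \<inter> space M | B. B \<in> sets borel})"
  proof (rule indep_set_sigma_sets)
    show "indep_set (cylinders s) {D -` B \<inter> space M | B. B \<in> sets borel}"
    proof (rule indep_setI)
      fix a b assume "a \<in> cylinders s" "b \<in> {D -` B \<inter> space M | B. B \<in> sets borel}"
      then show "prob (a \<inter> b) = prob a * prob b"
        using prob_cylinder_Int_increment[OF s] by (auto simp: D_def)
    qed (use cylinders_events D in \<open>auto intro: measurable_sets\<close>)
    show "Int_stable {D -` B \<inter> space M | B. B \<in> sets borel}"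
    proof (rule Int_stableI)
      fix b b' assume "b \<in> {D -` B \<inter> space M | B. B \<in> sets borel}" "b' \<in> {D -` B \<inter> space M | B. B \<in> sets borel}"
      then obtain B B' where "b = D -` B \<inter> space M" "b' = D -` B' \<inter> space M" "B \<in> sets borel" "B' \<in> sets borel"
        by blast
      then show "b \<inter> b' \<in> {D -` B \<inter> space M | B. B \<in> sets borel}"
        by (intro CollectI exI[of _ "B \<inter> B'"]) auto
    qed
  qed (rule Int_stable_cylinders)
  moreover have "sets (natural_filtration M X s) \<subseteq> sigma_sets (space M) (cylinders s)"
    unfolding sets_natural_filtration
  proof (rule sigma_sets_mono', clarify)
    fix r A assume "r \<in> {0..s}" "A \<in> sets (borel :: real measure)"
    then show "X r -` A \<inter> space M \<in> cylinders s"
      unfolding cylinders_def by (intro CollectI exI[of _ "{r}"] exI[of _ "\<lambda>_. A"]) auto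
  qed
  ultimately show ?thesis
    unfolding indep_set_def D_def
    by (elim indep_sets_mono_sets) (auto split: bool.split)
qed

lemma indep_var_increment:
  assumes s: "0 \<le> s" "s < t" and f: "f \<in> borel_measurable (natural_filtration M X s)"
  shows "indep_var borel f borel (\<lambda>\<omega>. X t \<omega> - X s \<omega>)"
  unfolding indep_var_eq
proof (intro conjI)
  show "random_variable borel f"
    using f subalgebra_natural_filtration by (rule measurable_from_subalg[rotated])
  show "random_variable borel (\<lambda>\<omega>. X t \<omega> - X s \<omega>)"
    using random_variable_X s by (intro borel_measurable_diff) auto
  have "{f -` A \<inter> space M | A. A \<in> sets borel} \<subseteq> sets (natural_filtration M X s)"
    using measurable_sets[OF f] by auto
  then have "sigma_sets (space M) {f -` A \<inter> space M | A. A \<in> sets borel} \<subseteq> sets (natural_filtration M X s)"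
    using sets.sigma_sets_subset[of _ "natural_filtration M X s"] by simp
  with indep_increment_natural_filtration[OF s]
  show "indep_set (sigma_sets (space M) {f -` A \<inter> space M | A. A \<in> sets borel})
      (sigma_sets (space M) {(\<lambda>\<omega>. X t \<omega> - X s \<omega>) -` B \<inter> space M | B. B \<in> sets borel})"
    unfolding indep_set_def by (elim indep_sets_mono_sets) (auto split: bool.split)
qed

end

section \<open>Formal moment generating series of a centered Levy process\<close>

text \<open>Subtracting \<open>t * f 1\<close> leaves an additive function that vanishes at
  integers, hence equals its value at the fractional part and is bounded. Since
  \<open>g (n * t) = n * g t\<close>, boundedness forces it to be zero.\<close>

lemma additive_bounded_imp_linear:
  fixes f :: "real \<Rightarrow> real"
  assumes add: "\<And>s t. 0 \<le> s \<Longrightarrow> 0 \<le> t \<Longrightarrow> f (s + t) = f s + f t"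
    and bound: "\<And>t. 0 \<le> t \<Longrightarrow> t \<le> 1 \<Longrightarrow> \<bar>f t\<bar> \<le> B"
    and t: "0 \<le> t"
  shows "f t = t * f 1"
proof -
  define g where "g t = f t - t * f 1" for t
  have g_add: "g (s + t) = g s + g t" if "0 \<le> s" "0 \<le> t" for s t
    using add[OF that] by (simp add: g_def algebra_simps)
  have g1: "g 1 = 0"
    by (simp add: g_def)
  have g_nat: "g (real n * t) = real n * g t" if "0 \<le> t" for n t
  proof (induction n)
    case 0
    show ?case using g_add[of 0 0] by simp
  next
    case (Suc n)
    then show ?case using g_add[of "real n * t" t] that by (simp add: algebra_simps)
  qed
  have g_bound: "\<bar>g t\<bar> \<le> 2 * B" if "0 \<le> t" for t
  proof -
    have "g t = g (real (nat \<lfloor>t\<rfloor>) * 1) + g (frac t)"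
      using g_add[of "real (nat \<lfloor>t\<rfloor>) * 1" "frac t"] that by (simp add: frac_def)
    also have "\<dots> = g (frac t)"
      using g_nat[of 1] g1 by simp
    finally have "\<bar>g t\<bar> \<le> \<bar>f (frac t)\<bar> + frac t * \<bar>f 1\<bar>"
      by (simp add: g_def abs_mult order_trans[OF abs_triangle_ineq4])
    moreover have "frac t * \<bar>f 1\<bar> \<le> 1 * B"
      using bound[of 1] frac_lt_1[of t] by (intro mult_mono) auto
    moreover have "\<bar>f (frac t)\<bar> \<le> B"
      using bound[of "frac t"] frac_lt_1[of t] by simp
    ultimately show ?thesis by simp
  qed
  have "g t = 0"
  proof (rule ccontr)
    assume "g t \<noteq> 0"
    then obtain n :: nat where "2 * B < real n * \<bar>g t\<bar>"
      using reals_Archimedean3[of "\<bar>g t\<bar>"] by auto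
    also have "\<dots> = \<bar>g (real n * t)\<bar>"
      using g_nat[OF t] by (simp add: abs_mult)
    also have "\<dots> \<le> 2 * B"
      using t by (intro g_bound) simp
    finally show False by simp
  qed
  then show ?thesis by (simp add: g_def)
qed

text \<open>Bernoulli's inequality for \<open>1 + b / a\<close>, scaled by the nonnegative number
  \<open>a ^ p\<close>.\<close>

lemma even_power_above_tangent:
  fixes a b :: real
  assumes "even p"
  shows "a ^ p + real p * a ^ (p - 1) * b \<le> (a + b) ^ p"
proof (cases "a = 0")
  case True
  then show ?thesis
    using assms by (cases "p = 0 \<or> p = 1") (auto simp: zero_le_even_power power_0_left)
next
  case False
  have "a ^ p * (1 + real p * (b / a)) \<le> a ^ p * (1 + b / a) ^ p"
    using assms by (intro mult_left_mono Bernoulli_inequality_even) (auto simp: zero_le_even_power)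
  also have "a ^ p * (1 + b / a) ^ p = (a + b) ^ p"
    using False by (simp add: power_mult_distrib[symmetric] distrib_left)
  also have "a ^ p * (1 + real p * (b / a)) = a ^ p + real p * a ^ (p - 1) * b"
    using False by (cases p) (auto simp: algebra_simps)
  finally show ?thesis .
qed

locale centered_levy_process = levy_process +
  assumes integrable_power: "0 \<le> t \<Longrightarrow> integrable M (\<lambda>\<omega>. X t \<omega> ^ k)"
    and expectation_eq_0: "0 \<le> t \<Longrightarrow> expectation (X t) = 0"
begin

lemma
  assumes st: "0 \<le> s" "s \<le> t"
  shows integrable_increment_power: "integrable M (\<lambda>\<omega>. (X t \<omega> - X s \<omega>) ^ k)"
    and expectation_increment_power: "expectation (\<lambda>\<omega>. (X t \<omega> - X s \<omega>) ^ k) = expectation (\<lambda>\<omega>. X (t - s) \<omega> ^ k)"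
proof -
  have [measurable]: "random_variable borel (X s)" "random_variable borel (X t)"
      "random_variable borel (X 0)" "random_variable borel (X (t - s))"
    using random_variable_X st by auto
  have "distr M borel (\<lambda>\<omega>. X t \<omega> - X s \<omega>) = distr M borel (\<lambda>\<omega>. X (t - s) \<omega> - X 0 \<omega>)"
    using stationary_increments[of s "t - s"] st by simp
  also have "\<dots> = distr M borel (X (t - s))"
    using start_zero by (intro distr_cong_AE) auto
  finally have distr: "distr M borel (\<lambda>\<omega>. X t \<omega> - X s \<omega>) = distr M borel (X (t - s))" .
  have "integrable (distr M borel (X (t - s))) (\<lambda>x. x ^ k)"
    using integrable_power[of "t - s" k] st by (simp add: integrable_distr_eq)
  then show "integrable M (\<lambda>\<omega>. (X t \<omega> - X s \<omega>) ^ k)"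
    by (simp add: distr[symmetric] integrable_distr_eq)
  have "expectation (\<lambda>\<omega>. (X t \<omega> - X s \<omega>) ^ k) = (LINT x|distr M borel (\<lambda>\<omega>. X t \<omega> - X s \<omega>). x ^ k)"
    by (simp add: integral_distr)
  also have "\<dots> = expectation (\<lambda>\<omega>. X (t - s) \<omega> ^ k)"
    by (simp add: distr integral_distr)
  finally show "expectation (\<lambda>\<omega>. (X t \<omega> - X s \<omega>) ^ k) = expectation (\<lambda>\<omega>. X (t - s) \<omega> ^ k)" .
qed

lemma
  assumes st: "0 \<le> s" "s \<le> t"
    and f: "f \<in> borel_measurable (natural_filtration M X s)" "integrable M f"
  shows integrable_mult_increment_power: "integrable M (\<lambda>\<omega>. f \<omega> * (X t \<omega> - X s \<omega>) ^ k)"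
    and expectation_mult_increment_power:
      "expectation (\<lambda>\<omega>. f \<omega> * (X t \<omega> - X s \<omega>) ^ k) = expectation f * expectation (\<lambda>\<omega>. X (t - s) \<omega> ^ k)"
proof -
  have "integrable M (\<lambda>\<omega>. f \<omega> * (X t \<omega> - X s \<omega>) ^ k) \<and>
      expectation (\<lambda>\<omega>. f \<omega> * (X t \<omega> - X s \<omega>) ^ k) = expectation f * expectation (\<lambda>\<omega>. (X t \<omega> - X s \<omega>) ^ k)"
  \<comment> \<open>\<open>indep_var_increment\<close> covers \<open>s < t\<close>; for
    \<open>s = t\<close> the power of the increment is a constant.\<close>
  proof (cases "s = t")
    case True
    then show ?thesis
      using f by (simp add: prob_space)
  next
    case False
    then have "indep_var borel ((\<lambda>x. x) \<circ> f) borel ((\<lambda>x. x ^ k) \<circ> (\<lambda>\<omega>. X t \<omega> - X s \<omega>))"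
      using st f by (intro indep_var_compose[OF indep_var_increment]) auto
    then have "indep_var borel f borel (\<lambda>\<omega>. (X t \<omega> - X s \<omega>) ^ k)"
      by (simp add: comp_def)
    then show ?thesis
      using indep_var_integrable indep_var_lebesgue_integral f(2) integrable_increment_power[OF st] by blast
  qed
  then show "integrable M (\<lambda>\<omega>. f \<omega> * (X t \<omega> - X s \<omega>) ^ k)"
    "expectation (\<lambda>\<omega>. f \<omega> * (X t \<omega> - X s \<omega>) ^ k) = expectation f * expectation (\<lambda>\<omega>. X (t - s) \<omega> ^ k)"
    by (simp_all add: expectation_increment_power[OF st])
qed

section \<open>Formal moment series, globally and on events of the past\<close>

text \<open>Restriction to \<open>A\<close> lets conditional expectations be tested on events of the
  filtration.\<close>

definition mgf_on :: "'a set \<Rightarrow> real \<Rightarrow> real fps" where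
  "mgf_on A t = Abs_fps (\<lambda>k. expectation (\<lambda>\<omega>. indicator A \<omega> * X t \<omega> ^ k) / fact k)"

definition mgf :: "real \<Rightarrow> real fps" where
  "mgf t = Abs_fps (\<lambda>k. expectation (\<lambda>\<omega>. X t \<omega> ^ k) / fact k)"

lemma mgf_on_space: "mgf_on (space M) t = mgf t"
  unfolding mgf_on_def mgf_def
  by (intro arg_cong[where f = Abs_fps] ext arg_cong2[where f = "(/)"] Bochner_Integration.integral_cong) auto

lemma mgf_nth_0 [simp]: "mgf t $ 0 = 1"
  by (simp add: mgf_def prob_space)

lemma inverse_mgf: "mgf t * inverse (mgf t) = 1"
  using inverse_mult_eq_1[of "mgf t"] by (simp add: mult.commute)

text \<open>Coefficientwise, \<open>exp (u * X t)\<close> is \<open>exp (u * X s)\<close> times the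
  exponential of an increment that is independent of the past and distributed as
  \<open>X (t - s)\<close>.\<close>

lemma mgf_on_split:
  assumes st: "0 \<le> s" "s \<le> t" and A: "A \<in> sets (natural_filtration M X s)"
  shows "mgf_on A t = mgf_on A s * mgf (t - s)"
proof (rule fps_ext)
  fix k
  define D where "D \<omega> = X t \<omega> - X s \<omega>" for \<omega>
  have A': "A \<in> events"
    using A subalgebra_natural_filtration by (auto simp: subalgebra_def)
  have f: "(\<lambda>\<omega>. indicator A \<omega> * X s \<omega> ^ i) \<in> borel_measurable (natural_filtration M X s)" for i
    using A st
    by (intro borel_measurable_times borel_measurable_power measurable_natural_filtration borel_measurable_indicator) auto
  have f': "integrable M (\<lambda>\<omega>. indicator A \<omega> * X s \<omega> ^ i)" for i
    using integrable_mult_indicator[OF A' integrable_power[OF st(1), of i]] by simp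
  note int = integrable_mult_increment_power[OF st f f', folded D_def]
  note exp = expectation_mult_increment_power[OF st f f', folded D_def]
  have exp_add: "X t \<omega> ^ k / fact k = (\<Sum>i=0..k. X s \<omega> ^ i / fact i * (D \<omega> ^ (k - i) / fact (k - i)))" for \<omega>
  proof -
    have "fps_exp (X s \<omega> + D \<omega>) $ k = (fps_exp (X s \<omega>) * fps_exp (D \<omega>)) $ k"
      by (simp only: fps_exp_add_mult)
    then show ?thesis
      by (simp add: fps_mult_nth D_def)
  qed
  have "indicator A \<omega> * X t \<omega> ^ k / fact k =
      (\<Sum>i=0..k. (indicator A \<omega> * X s \<omega> ^ i) * D \<omega> ^ (k - i) / (fact i * fact (k - i)))" for \<omega>
    unfolding times_divide_eq_right[symmetric] exp_add sum_distrib_left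
    by (intro sum.cong refl) simp
  then have "mgf_on A t $ k = expectation (\<lambda>\<omega>. \<Sum>i=0..k. (indicator A \<omega> * X s \<omega> ^ i) * D \<omega> ^ (k - i) / (fact i * fact (k - i)))"
    by (simp add: mgf_on_def flip: integral_divide_zero)
  also have "\<dots> = (\<Sum>i=0..k. expectation (\<lambda>\<omega>. (indicator A \<omega> * X s \<omega> ^ i) * D \<omega> ^ (k - i) / (fact i * fact (k - i))))"
    using int by (intro Bochner_Integration.integral_sum integrable_divide)
  also have "\<dots> = (mgf_on A s * mgf (t - s)) $ k"
    by (simp add: exp mgf_on_def mgf_def fps_mult_nth)
  finally show "mgf_on A t $ k = (mgf_on A s * mgf (t - s)) $ k" .
qed

lemma mgf_add:
  assumes "0 \<le> s" "0 \<le> t"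
  shows "mgf (s + t) = mgf s * mgf t"
  using mgf_on_split[of s "s + t" "space M"] sets.top[of "natural_filtration M X s"] assms
  by (simp add: mgf_on_space)

text \<open>Integrate the tangent inequality at \<open>X t\<close> with increment \<open>X 1 - X t\<close>, which is independent
  of \<open>X t\<close> and centered.\<close>

lemma expectation_even_power_mono:
  assumes t: "0 \<le> t" "t \<le> 1" and p: "even p"
  shows "expectation (\<lambda>\<omega>. X t \<omega> ^ p) \<le> expectation (\<lambda>\<omega>. X 1 \<omega> ^ p)"
proof -
  have f: "(\<lambda>\<omega>. X t \<omega> ^ (p - 1)) \<in> borel_measurable (natural_filtration M X t)"
    using t by (intro borel_measurable_power measurable_natural_filtration) auto
  note int = integrable_mult_increment_power[OF t f integrable_power[OF t(1)], of 1, simplified]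
  have "expectation (\<lambda>\<omega>. X t \<omega> ^ (p - 1) * (X 1 \<omega> - X t \<omega>)) = 0"
    using expectation_mult_increment_power[OF t f integrable_power[OF t(1)], of 1] t
    by (simp add: expectation_eq_0)
  then have "expectation (\<lambda>\<omega>. X t \<omega> ^ p) =
      expectation (\<lambda>\<omega>. X t \<omega> ^ p + real p * (X t \<omega> ^ (p - 1) * (X 1 \<omega> - X t \<omega>)))"
    using integrable_power[OF t(1), of p] int by simp
  also have "\<dots> \<le> expectation (\<lambda>\<omega>. X 1 \<omega> ^ p)"
  proof (rule integral_mono)
    show "integrable M (\<lambda>\<omega>. X t \<omega> ^ p + real p * (X t \<omega> ^ (p - 1) * (X 1 \<omega> - X t \<omega>)))"
      using integrable_power[OF t(1), of p] int by simp
    show "X t \<omega> ^ p + real p * (X t \<omega> ^ (p - 1) * (X 1 \<omega> - X t \<omega>)) \<le> X 1 \<omega> ^ p" for \<omega>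
      using even_power_above_tangent[OF p, of "X t \<omega>" "X 1 \<omega> - X t \<omega>"] by (simp add: mult.assoc)
  qed (simp add: integrable_power)
  finally show ?thesis .
qed

text \<open>\<open>\<bar>y\<bar> \<le> 1 + y\<^sup>2\<close> reduces to even moments, which are
  largest at time 1. Uniform boundedness on \<open>[0, 1]\<close> is written as big-O over a
  principal filter so that it is closed under sums and products.\<close>

lemma mgf_nth_bounded: "(\<lambda>t. mgf t $ k) \<in> O[principal {0..1}](\<lambda>_. 1)"
proof (rule bigoI[where c = "(1 + expectation (\<lambda>\<omega>. X 1 \<omega> ^ (2 * k))) / fact k"], unfold eventually_principal, rule ballI)
  fix t :: real assume "t \<in> {0..1}"
  then have t: "0 \<le> t" "t \<le> 1" by auto
  have "\<bar>expectation (\<lambda>\<omega>. X t \<omega> ^ k)\<bar> \<le> expectation (\<lambda>\<omega>. \<bar>X t \<omega> ^ k\<bar>)"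
    by (rule integral_abs_bound)
  also have "\<dots> \<le> expectation (\<lambda>\<omega>. 1 + X t \<omega> ^ (2 * k))"
  proof (rule integral_mono)
    fix \<omega>
    have "2 * \<bar>X t \<omega> ^ k\<bar> * 1 \<le> \<bar>X t \<omega> ^ k\<bar>\<^sup>2 + 1\<^sup>2"
      by (rule sum_squares_bound)
    then show "\<bar>X t \<omega> ^ k\<bar> \<le> 1 + X t \<omega> ^ (2 * k)"
      by (simp add: power_even_eq)
  qed (use t in \<open>auto intro!: integrable_power integrable_abs\<close>)
  also have "\<dots> = 1 + expectation (\<lambda>\<omega>. X t \<omega> ^ (2 * k))"
    using integrable_power[OF t(1)] by (simp add: prob_space)
  also have "\<dots> \<le> 1 + expectation (\<lambda>\<omega>. X 1 \<omega> ^ (2 * k))"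
    using expectation_even_power_mono[OF t] by simp
  finally show "norm (mgf t $ k) \<le> (1 + expectation (\<lambda>\<omega>. X 1 \<omega> ^ (2 * k))) / fact k * norm (1 :: real)"
    by (simp add: mgf_def divide_right_mono)
qed

section \<open>The logarithmic derivative of the moment series\<close>

text \<open>The derivative of the formal cumulant series, obtained without a formal logarithm;
  \<open>fact n\<close> times its \<open>n\<close>-th coefficient is the cumulant of order
  \<open>n + 1\<close>.\<close>

definition cgf_deriv :: "real \<Rightarrow> real fps" where
  "cgf_deriv t = fps_deriv (mgf t) * inverse (mgf t)"

lemma fps_deriv_mgf: "fps_deriv (mgf t) = cgf_deriv t * mgf t"
  using inverse_mgf[of t] by (simp add: cgf_deriv_def mult_ac)

text \<open>Since \<open>mgf t\<close> has constant term 1, \<open>fps_deriv_mgf\<close> can be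
  solved for the \<open>n\<close>-th coefficient in terms of moments and earlier
  coefficients.\<close>

lemma cgf_deriv_nth_bounded: "(\<lambda>t. cgf_deriv t $ n) \<in> O[principal {0..1}](\<lambda>_. 1)"
proof (induction n rule: less_induct)
  case (less n)
  have "cgf_deriv t $ n = of_nat (Suc n) * mgf t $ Suc n - (\<Sum>i<n. cgf_deriv t $ i * mgf t $ (n - i))" for t
  proof -
    have "fps_deriv (mgf t) $ n = (\<Sum>i\<in>{..<Suc n}. cgf_deriv t $ i * mgf t $ (n - i))"
      by (simp only: fps_deriv_mgf fps_mult_nth atLeast0AtMost lessThan_Suc_atMost)
    then show ?thesis by simp
  qed
  moreover have "(\<lambda>t. of_nat (Suc n) * mgf t $ Suc n - (\<Sum>i<n. cgf_deriv t $ i * mgf t $ (n - i)))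
      \<in> O[principal {0..1}](\<lambda>_. 1)"
  proof (intro sum_in_bigo(2) big_sum_in_bigo)
    show "(\<lambda>t. of_nat (Suc n) * mgf t $ Suc n) \<in> O[principal {0..1}](\<lambda>_. 1)"
      using mgf_nth_bounded[of "Suc n"] by (simp del: of_nat_Suc)
    fix i assume "i \<in> {..<n}"
    then show "(\<lambda>t. cgf_deriv t $ i * mgf t $ (n - i)) \<in> O[principal {0..1}](\<lambda>_. 1)"
      using landau_o.big.mult[OF less mgf_nth_bounded, of i "n - i"] by simp
  qed
  ultimately show ?case by simp
qed

lemma cgf_deriv_add:
  assumes "0 \<le> s" "0 \<le> t"
  shows "cgf_deriv (s + t) = cgf_deriv s + cgf_deriv t"
proof -
  have "cgf_deriv (s + t) = (fps_deriv (mgf s) * inverse (mgf s)) * (mgf t * inverse (mgf t)) +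
      (fps_deriv (mgf t) * inverse (mgf t)) * (mgf s * inverse (mgf s))"
    unfolding cgf_deriv_def mgf_add[OF assms] fps_inverse_mult fps_deriv_mult by (simp add: algebra_simps)
  then show ?thesis
    by (simp add: inverse_mgf cgf_deriv_def)
qed

lemma cgf_deriv_linear:
  assumes "0 \<le> t"
  shows "cgf_deriv t = fps_const t * cgf_deriv 1"
proof (rule fps_ext)
  fix n
  obtain c where c: "\<forall>\<^sub>F t in principal {0..1}. norm (cgf_deriv t $ n) \<le> c * norm (1::real)"
    using cgf_deriv_nth_bounded[of n] by (elim landau_o.bigE)
  have "cgf_deriv t $ n = t * cgf_deriv 1 $ n"
    by (rule additive_bounded_imp_linear[where f = "\<lambda>t. cgf_deriv t $ n" and B = c, OF _ _ assms])
       (use c in \<open>auto simp: cgf_deriv_add eventually_principal\<close>)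
  then show "cgf_deriv t $ n = (fps_const t * cgf_deriv 1) $ n"
    by simp
qed

text \<open>Degree 0 is the mean, which is zero by centering. The other degrees are cumulants of
  \<open>X 1\<close> with the index lowered by one, so the Gaussian variance sits at
  \<open>n = 1\<close>.\<close>

lemma cgf_deriv_nth:
  assumes triplet: "characteristic_triplet M X b v \<nu>"
  shows "fact n * cgf_deriv 1 $ n =
    (if n = 0 then 0 else (if n = 1 then v else 0) + (LINT x|\<nu>. x ^ Suc n))"
proof (cases n)
  case 0
  have "fps_deriv (mgf 1) $ 0 = (cgf_deriv 1 * mgf 1) $ 0"
    by (simp only: fps_deriv_mgf)
  then show ?thesis
    using expectation_eq_0[of 1] by (simp add: 0 mgf_def prob_space)
next
  case (Suc n')
  \<comment> \<open>The formal integral with constant term 0, which is the cumulant series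
    itself.\<close>
  define K where "K = fps_integral0 (cgf_deriv 1)"
  have "fact (Suc n) * K $ Suc n = (if Suc n = 2 then v else 0) + (LINT x|\<nu>. x ^ Suc n)"
  proof (rule levy_khintchine_cumulants[where X = "X 1"])
    show "levy_measure \<nu>" "\<And>u. char (distr M borel (X 1)) u = exp (levy_khintchine_exponent b v \<nu> u)"
      using triplet by (auto simp: characteristic_triplet_def)
    show "fps_deriv (Abs_fps (\<lambda>k. expectation (\<lambda>\<omega>. X 1 \<omega> ^ k) / fact k)) =
        fps_deriv K * Abs_fps (\<lambda>k. expectation (\<lambda>\<omega>. X 1 \<omega> ^ k) / fact k)"
      using fps_deriv_mgf[of 1] by (simp add: K_def mgf_def fps_deriv_fps_integral)
  qed (auto simp: Suc K_def prob_space_axioms random_variable_X integrable_power)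
  moreover have "fact (Suc n) * K $ Suc n = fact n * cgf_deriv 1 $ n"
    unfolding K_def fps_integral_nth_0_Suc fact_Suc by (simp del: of_nat_Suc)
  ultimately show ?thesis
    by (simp add: Suc del: power_Suc fact_Suc)
qed

section \<open>The exponential martingale and its coefficients\<close>

text \<open>Over an event \<open>A\<close> of the past, the integral at time \<open>t\<close> is a
  coefficient of \<open>mgf_on A t * inverse (mgf t)\<close>; both factors split at
  \<open>s\<close>, and the contributions of \<open>mgf (t - s)\<close> cancel.\<close>

lemma martingale_exp_mult_inverse_mgf:
  "martingale M (natural_filtration M X) (\<lambda>t \<omega>. (fps_exp (X t \<omega>) * inverse (mgf t)) $ n)"
proof -
  define Y where "Y t \<omega> = (fps_exp (X t \<omega>) * inverse (mgf t)) $ n" for t \<omega>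
  have Y_eq: "Y t \<omega> = (\<Sum>i=0..n. X t \<omega> ^ i / fact i * inverse (mgf t) $ (n - i))" for t \<omega>
    by (simp add: Y_def fps_mult_nth)
  have Y_meas: "Y t \<in> borel_measurable (natural_filtration M X t)" if "0 \<le> t" for t
    unfolding Y_eq[abs_def] using that
    by (intro borel_measurable_sum borel_measurable_times borel_measurable_divide borel_measurable_power
        measurable_natural_filtration) auto
  have Y_int: "integrable M (Y t)" if "0 \<le> t" for t
    unfolding Y_eq[abs_def] using integrable_power[OF that]
    by (intro Bochner_Integration.integrable_sum integrable_mult_left integrable_divide)
  have Y_on: "(LINT \<omega>:A|M. Y t \<omega>) = (mgf_on A t * inverse (mgf t)) $ n" if "A \<in> events" "0 \<le> t" for A t
  proof -
    have int: "integrable M (\<lambda>\<omega>. indicator A \<omega> * X t \<omega> ^ i)" for i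
      using integrable_mult_indicator[OF that(1) integrable_power[OF that(2), of i]] by simp
    have "(LINT \<omega>:A|M. Y t \<omega>) =
        expectation (\<lambda>\<omega>. \<Sum>i=0..n. indicator A \<omega> * X t \<omega> ^ i / fact i * inverse (mgf t) $ (n - i))"
      unfolding set_lebesgue_integral_def Y_eq by (simp add: sum_distrib_left mult_ac)
    also have "\<dots> = (\<Sum>i=0..n. expectation (\<lambda>\<omega>. indicator A \<omega> * X t \<omega> ^ i / fact i * inverse (mgf t) $ (n - i)))"
      using int by (intro Bochner_Integration.integral_sum integrable_mult_left integrable_divide)
    finally show ?thesis
      by (simp add: mgf_on_def fps_mult_nth)
  qed
  have cond: "AE \<omega> in M. real_cond_exp M (natural_filtration M X s) (Y t) \<omega> = Y s \<omega>" if st: "0 \<le> s" "s \<le> t" for s t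
  proof -
    interpret finite_measure_subalgebra M "natural_filtration M X s"
      by unfold_locales (rule subalgebra_natural_filtration)
    show ?thesis
    proof (rule real_cond_exp_charact)
      fix A assume A: "A \<in> sets (natural_filtration M X s)"
      then have A': "A \<in> events"
        using subalgebra_natural_filtration by (auto simp: subalgebra_def)
      have "mgf t = mgf s * mgf (t - s)"
        using mgf_add[of s "t - s"] st by simp
      then have "mgf_on A t * inverse (mgf t) = mgf_on A s * inverse (mgf s) * (mgf (t - s) * inverse (mgf (t - s)))"
        by (simp add: mgf_on_split[OF st A] fps_inverse_mult mult_ac)
      then show "(LINT \<omega>:A|M. Y t \<omega>) = (LINT \<omega>:A|M. Y s \<omega>)"
        using st A' by (simp add: Y_on inverse_mgf)
    qed (use st Y_int Y_meas in auto)
  qed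
  show ?thesis
    unfolding martingale_def Y_def[symmetric]
    using filtration_natural_filtration subalgebra_natural_filtration Y_meas Y_int cond by auto
qed

text \<open>Both generating functions solve the linear equation with coefficient \<open>A\<close>
  and have constant term 1.\<close>

lemma Gamma_poly_conv_mgf:
  assumes t: "0 \<le> t"
    and y: "y 1 = x" "\<And>n. n \<ge> 1 \<Longrightarrow> y (Suc n) = - t * (fact n * cgf_deriv 1 $ n)"
    and c0: "cgf_deriv 1 $ 0 = 0"
  shows "Gamma_poly n y = fact n * (fps_exp x * inverse (mgf t)) $ n"
proof -
  define G where "G = Abs_fps (\<lambda>n. Gamma_poly n y / fact n)"
  define A where "A = fps_const x - cgf_deriv t"
  have "G = fps_exp x * inverse (mgf t)"
  proof (rule fps_linear_ode_unique)
    have "Abs_fps (\<lambda>n. y (Suc n) / fact n) = A"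
    proof (rule fps_ext)
      fix n
      \<comment> \<open>In degree 0, \<open>c0\<close> ensures that \<open>A\<close> contributes
        exactly \<open>x\<close>.\<close>
      show "Abs_fps (\<lambda>n. y (Suc n) / fact n) $ n = A $ n"
        using y c0 by (cases n) (auto simp: A_def cgf_deriv_linear[OF t])
    qed
    then show "fps_deriv G = A * G"
      using fps_deriv_Gamma_poly[of y] by (simp add: G_def)
    have "fps_deriv (fps_exp x * inverse (mgf t)) = fps_const x * (fps_exp x * inverse (mgf t)) -
        cgf_deriv t * (mgf t * inverse (mgf t)) * (fps_exp x * inverse (mgf t))"
      by (simp add: fps_inverse_deriv fps_deriv_mgf power2_eq_square algebra_simps)
    then show "fps_deriv (fps_exp x * inverse (mgf t)) = A * (fps_exp x * inverse (mgf t))"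
      by (simp add: inverse_mgf A_def left_diff_distrib)
    show "G $ 0 = (fps_exp x * inverse (mgf t)) $ 0"
      by (simp add: G_def Gamma_poly_0)
  qed
  then have "G $ n = (fps_exp x * inverse (mgf t)) $ n"
    by simp
  then show ?thesis
    by (simp add: G_def field_simps)
qed

end

section \<open>Closure properties of martingales and the conclusion\<close>

lemma martingale_cmult:
  assumes "prob_space M" "martingale M F Y"
  shows "martingale M F (\<lambda>t \<omega>. c * Y t \<omega>)"
proof -
  interpret prob_space M by fact
  have cond: "AE \<omega> in M. real_cond_exp M (F s) (\<lambda>\<omega>. c * Y t \<omega>) \<omega> = c * Y s \<omega>" if st: "0 \<le> s" "s \<le> t" for s t
  proof -
    interpret finite_measure_subalgebra M "F s"
      using assms(2) st by unfold_locales (auto simp: martingale_def)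
    have "AE \<omega> in M. real_cond_exp M (F s) (\<lambda>\<omega>. c * Y t \<omega>) \<omega> = c * real_cond_exp M (F s) (Y t) \<omega>"
      using assms(2) st by (intro real_cond_exp_cmult) (auto simp: martingale_def)
    moreover have "AE \<omega> in M. real_cond_exp M (F s) (Y t) \<omega> = Y s \<omega>"
      using assms(2) st by (auto simp: martingale_def)
    ultimately show ?thesis by eventually_elim simp
  qed
  show ?thesis
    using assms(2) cond by (auto simp: martingale_def)
qed

lemma martingale_cong:
  assumes "martingale M F Y" "\<And>t \<omega>. 0 \<le> t \<Longrightarrow> Y t \<omega> = Z t \<omega>"
  shows "martingale M F Z"
proof -
  have "Y t = Z t" if "0 \<le> t" for t
    using assms(2)[OF that] by (rule ext)
  then show ?thesis
    using assms(1) unfolding martingale_def by (metis order_trans)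
qed

theorem theorem1:
  fixes M :: "'a measure" and X :: "real \<Rightarrow> 'a \<Rightarrow> real"
    and b \<sigma> :: real and \<nu> :: "real measure" and m :: "nat \<Rightarrow> real" and n :: nat
  assumes levy: "levy_process M X"
    and moments: "\<And>t p::real. 0 \<le> t \<Longrightarrow> 1 \<le> p \<Longrightarrow> integrable M (\<lambda>\<omega>. \<bar>X t \<omega>\<bar> powr p)"
    and centered: "\<And>t. 0 \<le> t \<Longrightarrow> (LINT \<omega>|M. X t \<omega>) = 0"
    and triplet: "characteristic_triplet M X b (\<sigma>\<^sup>2) \<nu>"
    and m_def: "\<And>k. 2 \<le> k \<Longrightarrow> m k = (LINT x|\<nu>. x ^ k)"
    and n: "1 \<le> n"
  shows "martingale M (natural_filtration M X)
    (\<lambda>t \<omega>. Gamma_poly n (\<lambda>k. if k = 1 then X t \<omega>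
                             else if k = 2 then - (m 2 + \<sigma>\<^sup>2) * t
                             else - m k * t))"
proof -
  interpret levy_process M X by fact
  interpret centered_levy_process M X
  proof
    fix t :: real and k assume t: "0 \<le> t"
    show "integrable M (\<lambda>\<omega>. X t \<omega> ^ k)"
    \<comment> \<open>\<open>moments\<close> covers exponents from 1 on; the power 0 is a constant
      on a probability space.\<close>
    proof (cases "k = 0")
      case False
      show ?thesis
      proof (rule Bochner_Integration.integrable_bound)
        show "integrable M (\<lambda>\<omega>. \<bar>X t \<omega>\<bar> powr real k)"
          using t False by (intro moments) auto
        show "(\<lambda>\<omega>. X t \<omega> ^ k) \<in> borel_measurable M"
          using random_variable_X[OF t] by (rule borel_measurable_power)
        show "AE \<omega> in M. norm (X t \<omega> ^ k) \<le> norm (\<bar>X t \<omega>\<bar> powr real k)"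
          using False by (intro AE_I2) (auto simp: powr_realpow' power_abs)
      qed
    qed simp
  qed (rule centered)
  note cgf = cgf_deriv_nth[OF triplet]
  have Gamma: "Gamma_poly n (\<lambda>k. if k = 1 then X t \<omega> else if k = 2 then - (m 2 + \<sigma>\<^sup>2) * t else - m k * t) =
      fact n * (fps_exp (X t \<omega>) * inverse (mgf t)) $ n" if t: "0 \<le> t" for t \<omega>
  proof (rule Gamma_poly_conv_mgf[OF t])
    \<comment> \<open>The argument of index \<open>Suc j\<close> corresponds to degree
      \<open>j\<close> of \<open>cgf_deriv\<close>; the Gaussian variance enters for
      \<open>j = 1\<close>.\<close>
    fix j :: nat assume "j \<ge> 1"
    then show "(if Suc j = 1 then X t \<omega> else if Suc j = 2 then - (m 2 + \<sigma>\<^sup>2) * t else - m (Suc j) * t) =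
        - t * (fact j * cgf_deriv 1 $ j)"
      unfolding cgf using m_def[of "Suc j"] by (auto simp: algebra_simps numeral_2_eq_2)
  qed (use cgf[of 0] in auto)
  have "martingale M (natural_filtration M X) (\<lambda>t \<omega>. fact n * (fps_exp (X t \<omega>) * inverse (mgf t)) $ n)"
    by (intro martingale_cmult martingale_exp_mult_inverse_mgf prob_space_axioms)
  then show ?thesis
    by (rule martingale_cong) (simp only: Gamma)
qed

end
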